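(* Let $K$ be a field of characteristic $0$, $q\in K^*$, $n\ge 2$, and let $D_q(n)$ be the Dipper–Donkin quantized matrix algebra over $K$. Then $D_q(n)$ is a solvable polynomial algebra (in the sense of the definition given in the context).
   Context: $\mathbb N$ includes $0$; $K^*=K\setminus\{0\}$. $D_q(n)$ is the associative unital $K$-algebra generated by the $n^2$ elements $d_{ij}$ ($1\le i,j\le n$) subject to: $d_{ij}d_{st}=qd_{st}d_{ij}$ if $i>s$ and $j\le t$; $d_{ij}d_{st}=d_{st}d_{ij}+(q-1)d_{sj}d_{it}$ if $i>s$ and $j>t$; $d_{ij}d_{ik}=d_{ik}d_{ij}$ for all $i,j,k$. Let $A=K[a_1,\dots,a_m]$ be a $K$-algebra finitely generated by $a_1,\dots,a_m$. It has the PBW $K$-basis $\mathcal B$ if $\mathcal B=\{a^\alpha=a_1^{\alpha_1}\cdots a_m^{\alpha_m}\mid \alpha\in\mathbb N^m\}$ is a $K$-basis of $A$. Given a total ordering $\prec$ on $\mathcal B$, the leading monomial $\mathbf{LM}(f)$ of a nonzero $f\in A$ is the $\prec$-largest element of $\mathcal B$ occurring in $f$ with nonzero coefficient (with $\mathbf{LM}(0)=0$). A total ordering $\prec$ on $\mathcal B$ is a monomial ordering if: (1) $\prec$ is a well-ordering; (2) for $a^\gamma,a^\alpha,a^\beta,a^\eta\in\mathcal B$, if $a^\gamma\ne 1$, $a^\beta\ne a^\gamma$ and $a^\gamma=\mathbf{LM}(a^\alpha a^\beta a^\eta)$, then $a^\beta\prec a^\gamma$ (thereby $1\prec a^\gamma$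 for all $a^\gamma\neq 1$); (3) for $a^\gamma,a^\alpha,a^\beta,a^\eta\in\mathcal B$, if $a^\alpha\prec a^\beta$, $\mathbf{LM}(a^\gamma a^\alpha a^\eta)\ne 0$ and $\mathbf{LM}(a^\gamma a^\beta a^\eta)\notin\{0,1\}$, then $\mathbf{LM}(a^\gamma a^\alpha a^\eta)\prec\mathbf{LM}(a^\gamma a^\beta a^\eta)$. $A$ is a solvable polynomial algebra if it has the PBW $K$-basis $\mathcal B$ and a monomial ordering $\prec$ on $\mathcal B$ such that for all $1\le i<j\le m$ there are $\lambda_{ji}\in K^*$ and $f_{ji}\in A$ with $a_ja_i=\lambda_{ji}a_ia_j+f_{ji}$ and $\mathbf{LM}(f_{ji})\prec a_ia_j$ whenever $f_{ji}\ne 0$. For $D_q(n)$ the PBW basis used is the one on the generators listed in the order $d_{11},d_{12},\dots,d_{1n},d_{21},\dots,d_{2n},\dots,d_{n1},\dots,d_{nn}$. *)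

theory Defs
  imports "HOL-Algebra.QuotRing" "HOL-Algebra.Algebraic_Closure_Type" "HOL-Library.Poly_Mapping"
begin

section \<open>Associative unital algebras over a field\<close>

text \<open>
  The ground field is a type of class \<^class>\<open>field\<close>; an algebra is a record of type
  \<^type>\<open>module\<close>. The library locale \<^locale>\<open>algebra\<close> covers commutative algebras only.
\<close>

locale assoc_algebra = module + ring M +
  assumes smult_mult_left:
      "\<lbrakk>a \<in> carrier R; x \<in> carrier M; y \<in> carrier M\<rbrakk> \<Longrightarrow>
      (a \<odot>\<^bsub>M\<^esub> x) \<otimes>\<^bsub>M\<^esub> y = a \<odot>\<^bsub>M\<^esub> (x \<otimes>\<^bsub>M\<^esub> y)"
    and smult_mult_right:
      "\<lbrakk>a \<in> carrier R; x \<in> carrier M; y \<in> carrier M\<rbrakk> \<Longrightarrow>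
      x \<otimes>\<^bsub>M\<^esub> (a \<odot>\<^bsub>M\<^esub> y) = a \<odot>\<^bsub>M\<^esub> (x \<otimes>\<^bsub>M\<^esub> y)"

definition generates_algebra :: "('k::field, 'a) module \<Rightarrow> 'a set \<Rightarrow> bool" where
  "generates_algebra A G \<longleftrightarrow> G \<subseteq> carrier A \<and>
     (\<forall>S \<subseteq> carrier A. G \<subseteq> S \<and> \<one>\<^bsub>A\<^esub> \<in> S \<and>
        (\<forall>x\<in>S. \<forall>y\<in>S. x \<oplus>\<^bsub>A\<^esub> y \<in> S \<and> x \<otimes>\<^bsub>A\<^esub> y \<in> S) \<and>
        (\<forall>c. \<forall>x\<in>S. c \<odot>\<^bsub>A\<^esub> x \<in> S) \<longrightarrow> S = carrier A)"

definition lin_comb :: "('k::field, 'a) module \<Rightarrow> ('a \<Rightarrow>\<^sub>0 'k) \<Rightarrow> 'a" where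
  "lin_comb A c = (\<Oplus>\<^bsub>A\<^esub>b\<in>Poly_Mapping.keys c. Poly_Mapping.lookup c b \<odot>\<^bsub>A\<^esub> b)"

definition is_basis :: "('k::field, 'a) module \<Rightarrow> 'a set \<Rightarrow> bool" where
  "is_basis A B \<longleftrightarrow> B \<subseteq> carrier A \<and>
     (\<forall>c. Poly_Mapping.keys c \<subseteq> B \<and> lin_comb A c = \<zero>\<^bsub>A\<^esub> \<longrightarrow> c = 0) \<and>
     (\<forall>f\<in>carrier A. \<exists>c. Poly_Mapping.keys c \<subseteq> B \<and> f = lin_comb A c)"

definition coords :: "('k::field, 'a) module \<Rightarrow> 'a set \<Rightarrow> 'a \<Rightarrow> ('a \<Rightarrow>\<^sub>0 'k)" where
  "coords A B f = (THE c. Poly_Mapping.keys c \<subseteq> B \<and> f = lin_comb A c)"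


section \<open>Solvable polynomial algebras\<close>

text \<open>The generators and the exponent vector are lists of the same length.\<close>

definition pbw_monomial :: "('k::field, 'a) module \<Rightarrow> 'a list \<Rightarrow> nat list \<Rightarrow> 'a" where
  "pbw_monomial A as \<alpha> =
     foldr (\<lambda>(a, k) x. (a [^]\<^bsub>A\<^esub> k) \<otimes>\<^bsub>A\<^esub> x) (zip as \<alpha>) \<one>\<^bsub>A\<^esub>"

definition pbw_monomials :: "('k::field, 'a) module \<Rightarrow> 'a list \<Rightarrow> 'a set" where
  "pbw_monomials A as = pbw_monomial A as ` {\<alpha>. length \<alpha> = length as}"

text \<open>
  The monomials form a basis as a family indexed by the exponent vectors: different
  exponent vectors give different monomials.
\<close>

definition has_pbw_basis :: "('k::field, 'a) module \<Rightarrow> 'a list \<Rightarrow> bool" where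
  "has_pbw_basis A as \<longleftrightarrow>
     inj_on (pbw_monomial A as) {\<alpha>. length \<alpha> = length as} \<and> is_basis A (pbw_monomials A as)"

text \<open>
  A strict ordering of a basis \<open>B\<close> is a relation \<open>r\<close>, with \<open>(x, y) \<in> r\<close> for ``\<open>x\<close> precedes \<open>y\<close>''.
\<close>

definition LM :: "('k::field, 'a) module \<Rightarrow> 'a set \<Rightarrow> 'a rel \<Rightarrow> 'a \<Rightarrow> 'a" where
  "LM A B r f =
     (if f = \<zero>\<^bsub>A\<^esub> then \<zero>\<^bsub>A\<^esub>
      else (THE b. b \<in> Poly_Mapping.keys (coords A B f) \<and>
              (\<forall>b'\<in>Poly_Mapping.keys (coords A B f). b' \<noteq> b \<longrightarrow> (b', b) \<in> r)))"

definition monomial_ordering :: "('k::field, 'a) module \<Rightarrow> 'a set \<Rightarrow> 'a rel \<Rightarrow> bool" where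
  "monomial_ordering A B r \<longleftrightarrow>
     r \<subseteq> B \<times> B \<and> strict_linear_order_on B r \<and> wf r \<and>
     (\<forall>u\<in>B. \<forall>a\<in>B. \<forall>b\<in>B. \<forall>e\<in>B.
        u \<noteq> \<one>\<^bsub>A\<^esub> \<and> b \<noteq> u \<and> u = LM A B r (a \<otimes>\<^bsub>A\<^esub> b \<otimes>\<^bsub>A\<^esub> e) \<longrightarrow> (b, u) \<in> r) \<and>
     (\<forall>u\<in>B. \<forall>a\<in>B. \<forall>b\<in>B. \<forall>e\<in>B.
        (a, b) \<in> r \<and> LM A B r (u \<otimes>\<^bsub>A\<^esub> a \<otimes>\<^bsub>A\<^esub> e) \<noteq> \<zero>\<^bsub>A\<^esub> \<and>
        LM A B r (u \<otimes>\<^bsub>A\<^esub> b \<otimes>\<^bsub>A\<^esub> e) \<notin> {\<zero>\<^bsub>A\<^esub>, \<one>\<^bsub>A\<^esub>} \<longrightarrow>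
        (LM A B r (u \<otimes>\<^bsub>A\<^esub> a \<otimes>\<^bsub>A\<^esub> e), LM A B r (u \<otimes>\<^bsub>A\<^esub> b \<otimes>\<^bsub>A\<^esub> e)) \<in> r)"

definition solvable_polynomial_algebra :: "('k::field, 'a) module \<Rightarrow> 'a list \<Rightarrow> bool" where
  "solvable_polynomial_algebra A as \<longleftrightarrow>
     assoc_algebra (ring_of_type_algebra :: 'k ring) A \<and>
     generates_algebra A (set as) \<and>
     has_pbw_basis A as \<and>
     (\<exists>r. monomial_ordering A (pbw_monomials A as) r \<and>
        (\<forall>i j. i < j \<and> j < length as \<longrightarrow>
           (\<exists>l f. l \<noteq> (0::'k) \<and> f \<in> carrier A \<and>
              as ! j \<otimes>\<^bsub>A\<^esub> as ! i = l \<odot>\<^bsub>A\<^esub> (as ! i \<otimes>\<^bsub>A\<^esub> as ! j) \<oplus>\<^bsub>A\<^esub> f \<and>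
              (f \<noteq> \<zero>\<^bsub>A\<^esub> \<longrightarrow> (LM A (pbw_monomials A as) r f, as ! i \<otimes>\<^bsub>A\<^esub> as ! j) \<in> r))))"


section \<open>Free algebras and algebras given by generators and relations\<close>

text \<open>
  Words form a non-commutative monoid, written additively as \<^type>\<open>poly_mapping\<close> requires;
  the finitely supported functions on words, with the convolution product of the library,
  are then the free algebra on the type of all letters.
\<close>

datatype 'g word = Word (letters: "'g list")

instantiation word :: (type) monoid_add
begin

definition zero_word :: "'g word" where
  "zero_word = Word []"

definition plus_word :: "'g word \<Rightarrow> 'g word \<Rightarrow> 'g word" where
  "plus_word u v = Word (letters u @ letters v)"

instance
  by standard (simp_all add: zero_word_def plus_word_def)

end

definition scalar :: "'k::field \<Rightarrow> ('g word \<Rightarrow>\<^sub>0 'k)" where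
  "scalar c = Poly_Mapping.single 0 c"

definition free_gen :: "'g \<Rightarrow> ('g word \<Rightarrow>\<^sub>0 'k::field)" where
  "free_gen g = Poly_Mapping.single (Word [g]) 1"

definition free_algebra :: "'g set \<Rightarrow> ('k::field, 'g word \<Rightarrow>\<^sub>0 'k) module" where
  "free_algebra L =
     \<lparr>carrier = {p. \<forall>w\<in>Poly_Mapping.keys p. set (letters w) \<subseteq> L},
      monoid.mult = (*), one = 1, ring.zero = 0, add = (+),
      module.smult = (\<lambda>c p. scalar c * p)\<rparr>"

definition quotient_algebra :: "('k::field, 'a) module \<Rightarrow> 'a set \<Rightarrow> ('k, 'a set) module" where
  "quotient_algebra A I =
     \<lparr>carrier = carrier (A Quot I), monoid.mult = monoid.mult (A Quot I), one = one (A Quot I),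
      ring.zero = ring.zero (A Quot I), add = add (A Quot I),
      module.smult = (\<lambda>c C. \<Union>x\<in>C. I +>\<^bsub>A\<^esub> (c \<odot>\<^bsub>A\<^esub> x))\<rparr>"


section \<open>The Dipper--Donkin quantized matrix algebra\<close>

definition dd_relations :: "'k::field \<Rightarrow> nat \<Rightarrow> ((nat \<times> nat) word \<Rightarrow>\<^sub>0 'k) set" where
  "dd_relations q n =
     {free_gen (i, j) * free_gen (s, t) - scalar q * (free_gen (s, t) * free_gen (i, j)) | i j s t.
        {i, j, s, t} \<subseteq> {1..n} \<and> i > s \<and> j \<le> t}
   \<union> {free_gen (i, j) * free_gen (s, t) -
        (free_gen (s, t) * free_gen (i, j)
          + scalar (q - 1) * (free_gen (s, j) * free_gen (i, t))) | i j s t.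
        {i, j, s, t} \<subseteq> {1..n} \<and> i > s \<and> j > t}
   \<union> {free_gen (i, j) * free_gen (i, k) - free_gen (i, k) * free_gen (i, j) | i j k.
        {i, j, k} \<subseteq> {1..n}}"

definition dd_free_algebra :: "nat \<Rightarrow> ('k::field, (nat \<times> nat) word \<Rightarrow>\<^sub>0 'k) module" where
  "dd_free_algebra n = free_algebra ({1..n} \<times> {1..n})"

definition dd_ideal :: "'k::field \<Rightarrow> nat \<Rightarrow> ((nat \<times> nat) word \<Rightarrow>\<^sub>0 'k) set" where
  "dd_ideal q n = genideal (dd_free_algebra n :: ('k, (nat \<times> nat) word \<Rightarrow>\<^sub>0 'k) module) (dd_relations q n)"

definition dipper_donkin ::
    "'k::field \<Rightarrow> nat \<Rightarrow> ('k, ((nat \<times> nat) word \<Rightarrow>\<^sub>0 'k) set) module" where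
  "dipper_donkin q n = quotient_algebra (dd_free_algebra n) (dd_ideal q n)"

definition dd_gen ::
    "'k::field \<Rightarrow> nat \<Rightarrow> nat \<times> nat \<Rightarrow> ((nat \<times> nat) word \<Rightarrow>\<^sub>0 'k) set" where
  "dd_gen q n ij =
     dd_ideal q n +>\<^bsub>dd_free_algebra n :: ('k, (nat \<times> nat) word \<Rightarrow>\<^sub>0 'k) module\<^esub> free_gen ij"

text \<open>\<^const>\<open>List.product\<close> enumerates the index pairs row by row.\<close>

definition dd_gens ::
    "'k::field \<Rightarrow> nat \<Rightarrow> ((nat \<times> nat) word \<Rightarrow>\<^sub>0 'k) set list" where
  "dd_gens q n = map (dd_gen q n) (List.product [1..<Suc n] [1..<Suc n])"

end

theory Submission
  imports Defs "HOL-Library.Multiset_Order"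
begin

text \<open>
  Order monomials first by total weight, where \<open>d\<^sub>i\<^sub>j\<close> has weight \<open>i * j\<close>, and then by the multiset
  order. For \<open>i > s\<close> and \<open>j > t\<close> we have \<open>s * j + i * t < i * j + s * t\<close>, so the correction term of the
  second relation is lower, and every word straightens to a nonzero multiple of the sorted word plus
  lower terms. The ordered monomials therefore span, and leading monomials multiply like commutative
  monomials, once linear independence is known.

  Linear independence follows from a representation on the functions on multisets of index pairs
  in which the ordered monomials send the unit vector at the empty multiset to distinct unit vectors.
  It is the iterated coproduct of representations of single rows: row \<open>s\<close> acts by multiplication
  operators \<open>X\<^sub>j\<close>, the scaling operators \<open>Q\<^sub>k\<close>, which multiply by \<open>q\<close> to the number of entries
  \<open>(s, t)\<close> with \<open>t \<ge> k\<close>, and the operators \<open>A\<^sub>k = X\<^sub>k\<^sup>-\<^sup>1 (Q\<^sub>k - Q\<^sub>k\<^sub>+\<^sub>1)\<close>.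
\<close>

section \<open>Linear operators on a space of functions\<close>

text \<open>Straightening alone shows only that the sorted words span. Reading off independence from
  confluence would mean resolving every overlap of three generators; a model in which sorted words
  are visibly distinct avoids that. Let \<open>X_s\<close> be the row vector with entries
  \<open>opX s j\<close> and \<open>Z_s\<close> the matrix with entries
  \<open>dd_step q s k j\<close>, \<open>1 \<le> k\<close>. The generator \<open>d_ij\<close> acts
  as entry \<open>j\<close> of \<open>X_i Z_(i-1) ... Z_0\<close>. Only the relations inside one
  \<open>Z_s\<close>, and between \<open>X_s\<close> and \<open>Z_s\<close>, need explicit
  computation, since operators belonging to different rows commute. The operator \<open>A_k\<close>
  is \<open>q - 1\<close> times the Jackson q-derivative in \<open>X_k\<close>, composed with
  \<open>Q_(k+1)\<close>. It therefore kills every vector free of \<open>X_k\<close>, so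
  \<open>Z_s\<close> is the identity matrix wherever row \<open>s\<close> is empty. A word acts from
  its right end, and in a sorted word each letter finds all rows above its own still empty, so it
  simply inserts its own index pair.\<close>

typedef (overloaded) ('e, 'k) linop =
  "{F :: ('e \<Rightarrow> 'k::field) \<Rightarrow> ('e \<Rightarrow> 'k).
     (\<forall>f g. F (\<lambda>x. f x + g x) = (\<lambda>x. F f x + F g x)) \<and>
     (\<forall>c f. F (\<lambda>x. c * f x) = (\<lambda>x. c * F f x))}"
  morphisms op_apply Abs_linop
  by (rule exI[of _ "\<lambda>f. f"]) simp

setup_lifting type_definition_linop

instantiation linop :: (type, field) ring_1
begin

lift_definition zero_linop :: "('a, 'b) linop" is "\<lambda>f x. 0" by simp
lift_definition one_linop :: "('a, 'b) linop" is "\<lambda>f. f" by simp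
lift_definition plus_linop :: "('a, 'b) linop \<Rightarrow> ('a, 'b) linop \<Rightarrow> ('a, 'b) linop"
  is "\<lambda>F G f x. F f x + G f x" by (simp add: algebra_simps)
lift_definition minus_linop :: "('a, 'b) linop \<Rightarrow> ('a, 'b) linop \<Rightarrow> ('a, 'b) linop"
  is "\<lambda>F G f x. F f x - G f x" by (simp add: algebra_simps)
lift_definition uminus_linop :: "('a, 'b) linop \<Rightarrow> ('a, 'b) linop"
  is "\<lambda>F f x. - F f x" by simp
lift_definition times_linop :: "('a, 'b) linop \<Rightarrow> ('a, 'b) linop \<Rightarrow> ('a, 'b) linop"
  is "\<lambda>F G f. F (G f)" by simp

instance
proof
  show "(0 :: ('a, 'b) linop) \<noteq> 1"
    by transfer (auto simp: fun_eq_iff intro!: exI[of _ "\<lambda>_. 1"])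
qed (transfer; simp add: fun_eq_iff algebra_simps)+

end

lift_definition op_scale :: "'k::field \<Rightarrow> ('e, 'k) linop \<Rightarrow> ('e, 'k) linop" (infixr "\<star>" 75)
  is "\<lambda>c F f x. c * F f x" by (simp add: algebra_simps)

lemma op_scale_mult_left [simp]: "(c \<star> F) * G = c \<star> (F * G)"
  by transfer simp

lemma op_scale_mult_right [simp]: "F * (c \<star> G) = c \<star> (F * G)"
  by transfer simp

lemma op_scale_add: "c \<star> (F + G) = c \<star> F + c \<star> G"
  by transfer (simp add: algebra_simps)

lemma op_scale_diff: "c \<star> (F - G) = c \<star> F - c \<star> G"
  by transfer (simp add: algebra_simps)

lemma op_scale_diff_left: "(c - d) \<star> F = c \<star> F - d \<star> F"
  by transfer (simp add: algebra_simps)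

lemma op_scale_add_left: "(c + d) \<star> F = c \<star> F + d \<star> F"
  by transfer (simp add: algebra_simps)

lemma op_scale_scale [simp]: "c \<star> d \<star> F = (c * d) \<star> F"
  by transfer (simp add: algebra_simps)

lemma op_scale_zero [simp]: "c \<star> 0 = 0" "0 \<star> F = 0"
  by (transfer; simp)+

lemma op_scale_one [simp]: "1 \<star> F = F"
  by transfer simp

lemma op_scale_sum: "c \<star> sum F S = (\<Sum>x\<in>S. c \<star> F x)"
  by (induction S rule: infinite_finite_induct) (simp_all add: op_scale_add)

lemmas op_scale_simps = op_scale_add op_scale_diff op_scale_diff_left op_scale_add_left

section \<open>A representation of the Dipper--Donkin relations\<close>

type_synonym 'k mop = "((nat \<times> nat) multiset, 'k) linop"

section \<open>Raising, scaling and lowering operators of one row\<close>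

definition tail :: "nat \<Rightarrow> nat \<Rightarrow> (nat \<times> nat) multiset \<Rightarrow> nat" where
  "tail s k M = size (filter_mset (\<lambda>e. fst e = s \<and> k \<le> snd e) M)"

lemma tail_add_mset [simp]:
  "tail s k (add_mset e M) = (if fst e = s \<and> k \<le> snd e then Suc (tail s k M) else tail s k M)"
  by (simp add: tail_def)

lemma tail_empty_row: "(\<And>e. e \<in># M \<Longrightarrow> fst e \<noteq> s) \<Longrightarrow> tail s k M = 0"
  by (auto simp: tail_def filter_mset_eq_conv)

lemma tail_eq_Suc: "(s, k) \<notin># M \<Longrightarrow> tail s k M = tail s (Suc k) M"
  unfolding tail_def
  by (intro arg_cong[of _ _ size] filter_mset_cong) (auto simp: Suc_le_eq order_le_less)

text \<open>The value \<open>f M\<close> is the coefficient at \<open>M\<close>, so multiplication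
  by a variable, which sends the unit vector at \<open>M\<close> to the one at
  \<open>M + {#(s, j)#}\<close>, becomes a shift of the argument in the opposite direction.\<close>

lift_definition opX :: "nat \<Rightarrow> nat \<Rightarrow> 'k::field mop"
  is "\<lambda>s j f M. if (s, j) \<in># M then f (M - {#(s, j)#}) else 0" by (auto simp: fun_eq_iff)

lift_definition opQ :: "'k::field \<Rightarrow> nat \<Rightarrow> nat \<Rightarrow> 'k mop"
  is "\<lambda>q s k f M. q ^ tail s k M * f M" by (auto simp: fun_eq_iff algebra_simps)

text \<open>\<open>A\<^sub>k = X\<^sub>k\<^sup>-\<^sup>1 (Q\<^sub>k - Q\<^sub>k\<^sub>+\<^sub>1)\<close> is defined without inverting \<open>X\<^sub>k\<close>: the difference vanishes on the
  multisets without \<open>(s, k)\<close>.\<close>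

lift_definition opA :: "'k::field \<Rightarrow> nat \<Rightarrow> nat \<Rightarrow> 'k mop"
  is "\<lambda>q s k f M. (q ^ Suc (tail s k M) - q ^ tail s (Suc k) M) * f (add_mset (s, k) M)"
  by (auto simp: fun_eq_iff algebra_simps)

lemma opX_commute: "opX s j * opX s' t = opX s' t * opX s j"
proof (transfer, intro ext, goal_cases)
  case (1 s j s' t f M)
  show ?case
    by (cases "(s, j) = (s', t)"; cases "(s, j) \<in># M"; cases "(s', t) \<in># M")
      (auto simp: in_diff_count diff_right_commute dest!: multi_member_split)
qed

lemma opQ_commute: "opQ q s k * opQ q s' m = opQ q s' m * opQ q s k"
  by transfer (simp add: fun_eq_iff)

lemma opQ_opX:
  "opQ q s k * opX s' t = (if s = s' \<and> k \<le> t then q \<star> (opX s' t * opQ q s k) else opX s' t * opQ q s k)"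
  by transfer (auto simp: fun_eq_iff dest!: multi_member_split)

text \<open>Moving \<open>X_t\<close> through \<open>Q_k - Q_(k+1)\<close> multiplies by
  \<open>q\<close> exactly those of the two terms whose threshold is at most \<open>t\<close>: both
  if \<open>k < t\<close>, only \<open>Q_k\<close> if \<open>k = t\<close>, none if
  \<open>t < k\<close>.\<close>

lemma opA_opX:
  "opA q s k * opX s' t =
    (if s = s' \<and> k < t then q \<star> (opX s' t * opA q s k)
     else if s = s' \<and> k = t then q \<star> opQ q s k - opQ q s (Suc k)
     else opX s' t * opA q s k)"
  by transfer (auto simp: fun_eq_iff algebra_simps add_mset_commute dest!: multi_member_split)

text \<open>\<open>X_k\<close> cancels the inverse in \<open>A_k\<close>. At a multiset without
  \<open>(s, k)\<close>, where the left side vanishes, the two tails agree and so do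
  \<open>Q_k\<close> and \<open>Q_(k+1)\<close>.\<close>

lemma opX_opA: "opX s k * opA q s k = opQ q s k - opQ q s (Suc k)"
  by transfer (auto simp: fun_eq_iff algebra_simps tail_eq_Suc dest!: multi_member_split)

lemma opA_opQ:
  "opA q s k * opQ q s' m =
    (if s = s' \<and> m \<le> k then q \<star> (opQ q s' m * opA q s k) else opQ q s' m * opA q s k)"
  by transfer (auto simp: fun_eq_iff algebra_simps)

text \<open>\<open>A_k\<close> removes an entry counted by both \<open>Q_m\<close> and
  \<open>Q_(m+1)\<close>, so \<open>A_m\<close> acting afterwards finds them smaller by a factor
  \<open>q\<close>; removing an entry in column \<open>m\<close> leaves \<open>Q_k\<close> and
  \<open>Q_(k+1)\<close> unchanged.\<close>

lemma opA_opA: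
  "m < k \<Longrightarrow> opA q s k * opA q s m = q \<star> (opA q s m * opA q s k)"
  by transfer (auto simp: fun_eq_iff algebra_simps add_mset_commute)

lemma opA_commute_row:
  "s \<noteq> s' \<Longrightarrow> opA q s k * opA q s' m = opA q s' m * opA q s k"
  by transfer (auto simp: fun_eq_iff algebra_simps add_mset_commute)

text \<open>Entry \<open>(k, j)\<close> of the matrix of row \<open>s\<close>; its row 0 is an extra row holding the \<open>X\<^sub>j\<close>, below which
  the matrix is upper triangular.\<close>

definition dd_step :: "'k::field \<Rightarrow> nat \<Rightarrow> nat \<Rightarrow> nat \<Rightarrow> 'k mop" where
  "dd_step q s k j =
     (if k = 0 then opX s j else if k = j then opQ q s j
      else if k < j then opX s j * opA q s k else 0)"

text \<open>To the right of the diagonal, \<open>X_j A_k X_t A_k = q X_j X_t A_k A_k\<close> is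
  symmetric in \<open>j\<close> and \<open>t\<close>. Against the diagonal entry,
  \<open>A_k Q_k\<close> and \<open>Q_k X_j\<close> produce the same factor
  \<open>q\<close>.\<close>

lemma dd_step_commute: "dd_step q s k j * dd_step q s k t = dd_step q s k t * dd_step q s k j"
proof -
  have 1: "opX s j * opA q s k * (opX s t * opA q s k) = opX s t * opA q s k * (opX s j * opA q s k)"
    if "k < j" "k < t" for j t
    using that
    by (simp add: mult.assoc mult.assoc[symmetric, of "opA q s k" "opX s _"] opA_opX)
      (simp add: mult.assoc[symmetric] opX_commute)
  have 2: "opX s j * opA q s k * opQ q s k = opQ q s k * (opX s j * opA q s k)" if "k < j" for j
    using that by (simp add: mult.assoc opA_opQ) (simp add: mult.assoc[symmetric] opQ_opX)
  show ?thesis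
    using 1[of j t] 2[of j] 2[of t] by (auto simp: dd_step_def opX_commute)
qed

lemma opX_left_commute: "opX s t * (opX s' j * F) = opX s' j * (opX s t * F)"
  by (simp add: mult.assoc[symmetric] opX_commute)

lemma opA_opX_mult:
  "opA q s k * (opX s t * F) =
    (if k < t then q \<star> (opX s t * (opA q s k * F))
     else if k = t then q \<star> (opQ q s k * F) - opQ q s (Suc k) * F
     else opX s t * (opA q s k * F))"
  using arg_cong[OF opA_opX[of q s k s t], of "\<lambda>G. G * F"] by (auto simp: mult.assoc left_diff_distrib)

lemma opQ_opX_mult:
  "opQ q s k * (opX s t * F) =
    (if k \<le> t then q \<star> (opX s t * (opQ q s k * F)) else opX s t * (opQ q s k * F))"
  using arg_cong[OF opQ_opX[of q s k s t], of "\<lambda>G. G * F"] by (auto simp: mult.assoc)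

text \<open>The decisive case is \<open>t = k < j\<close>, where both sides equal
  \<open>q X_j Q_k - X_j Q_(k+1)\<close>. The other cases need only q-commutation.\<close>

lemma dd_step_opX:
  assumes "0 < k"
  shows "dd_step q s k j * opX s t =
    (if j \<le> t then q \<star> (opX s t * dd_step q s k j)
     else opX s t * dd_step q s k j + (q - 1) \<star> (opX s j * dd_step q s k t))"
proof -
  have "opX s k * (opX s j * opA q s k) = opX s j * (opQ q s k - opQ q s (Suc k))" for j
    using opX_opA[of s k q] by (simp add: opX_left_commute[of s k])
  then show ?thesis using assms
    by (auto simp: dd_step_def opQ_opX opA_opX mult.assoc opX_left_commute op_scale_simps
        right_diff_distrib)
qed

text \<open>The case split decides for each entry whether it lies left of, on or right of the
  diagonal. Column \<open>t\<close> is also compared with \<open>l\<close>, because the correction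
  term takes it from row \<open>l\<close>.\<close>

lemma dd_step_less:
  assumes "m < l"
  shows "dd_step q s l j * dd_step q s m t =
    (if j \<le> t then q \<star> (dd_step q s m t * dd_step q s l j)
     else dd_step q s m t * dd_step q s l j + (q - 1) \<star> (dd_step q s m j * dd_step q s l t))"
proof (cases "m = 0")
  case True
  then show ?thesis
    using assms dd_step_opX[of l q s j t] by (simp add: dd_step_def)
next
  case False
  note rules = dd_step_def mult.assoc opA_opX_mult opQ_opX_mult opA_opQ opA_opA[OF assms]
    opX_left_commute[of s t s j] op_scale_simps
  consider "j < l" | "j = l" "t < m" | "j = l" "t = m" | "j = l" "m < t" | "l < j" "t < m" | "l < j" "t = m"
    | "l < j" "m < t" "t < l" | "l < j" "t = l" | "l < j" "l < t"
    using less_linear[of j l] less_linear[of t m] less_linear[of t l] by blast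
  then show ?thesis
  proof cases
    \<comment> \<open>The only case in which \<open>A_l\<close> meets its own \<open>X_l\<close>.
      The term \<open>q X_l X_j A_m A_l\<close> on the right must be turned into scaling operators
      by \<open>opX_opA\<close> before the two sides can be compared.\<close>
    case 8
    have "q \<star> (opX s l * (opA q s m * opA q s l)) = opQ q s l * opA q s m - opQ q s (Suc l) * opA q s m"
      using arg_cong[OF opX_opA[of s l q], of "\<lambda>G. G * opA q s m"]
      by (simp add: mult.assoc opA_opA[OF assms] left_diff_distrib)
    then have "q \<star> (opX s l * (opX s j * (opA q s m * opA q s l))) =
        opX s j * (opQ q s l * opA q s m - opQ q s (Suc l) * opA q s m)"
      by (metis opX_left_commute op_scale_mult_right)
    then show ?thesis
      using assms False 8 by (simp add: rules right_diff_distrib)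
  qed (use assms False in \<open>simp_all add: rules opQ_commute[of q s l s m] left_diff_distrib\<close>)
qed

lemma dd_step_commute_row:
  assumes "s \<noteq> s'"
  shows "dd_step q s k j * dd_step q s' m t = dd_step q s' m t * dd_step q s k j"
proof -
  have AX: "opA q s k * opX s' t = opX s' t * opA q s k" if "s \<noteq> s'" for s s' k t
    using that by (simp add: opA_opX)
  have QX: "opQ q s k * opX s' t = opX s' t * opQ q s k" if "s \<noteq> s'" for s s' k t
    using that by (simp add: opQ_opX)
  have AQ: "opA q s k * opQ q s' t = opQ q s' t * opA q s k" if "s \<noteq> s'" for s s' k t
    using that by (simp add: opA_opQ)
  note c = opX_commute[of s _ s'] opQ_commute[of q s _ s'] opA_commute_row[OF assms]
    AX[OF assms] QX[OF assms] AQ[OF assms] AX[OF assms[symmetric], symmetric]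
    QX[OF assms[symmetric], symmetric] AQ[OF assms[symmetric], symmetric]
  have mult: "F * (G * H) = G * H * F" if "F * G = G * F" "F * H = H * F" for F G H :: "'a mop"
    using that by (metis mult.assoc)
  have mult': "G * H * F = F * (G * H)" if "G * F = F * G" "H * F = F * H" for F G H :: "'a mop"
    using that by (metis mult.assoc)
  show ?thesis
    unfolding dd_step_def by (auto intro!: mult mult' c)
qed

text \<open>Entry \<open>j\<close> of the row vector \<open>X_(s+d) Z_(s+d-1) ... Z_s\<close>, that
  is, the operator of row number \<open>s + d\<close>. The sum starts at \<open>k = 1\<close>: row 0
  of a step matrix holds the \<open>X_j\<close> and enters only where the recursion ends.\<close>

primrec dd_op :: "'k::field \<Rightarrow> nat \<Rightarrow> nat \<Rightarrow> nat \<Rightarrow> nat \<Rightarrow> 'k mop" where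
  "dd_op q n s 0 j = dd_step q s 0 j"
| "dd_op q n s (Suc d) j = (\<Sum>k=1..n. dd_step q s k j * dd_op q n (Suc s) d k)"

lemma dd_step_dd_op_commute:
  "s' < s \<Longrightarrow> dd_step q s' k j * dd_op q n s d t = dd_op q n s d t * dd_step q s' k j"
proof (induction d arbitrary: s t)
  case 0
  then show ?case by (simp add: dd_step_commute_row)
next
  case (Suc d)
  have "dd_step q s' k j * (dd_step q s i t * dd_op q n (Suc s) d i) =
      dd_step q s i t * dd_op q n (Suc s) d i * dd_step q s' k j" for i
  proof -
    have 1: "dd_step q s' k j * dd_step q s i t = dd_step q s i t * dd_step q s' k j"
      using Suc.prems by (simp add: dd_step_commute_row)
    have 2: "dd_step q s' k j * dd_op q n (Suc s) d i = dd_op q n (Suc s) d i * dd_step q s' k j"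
      using Suc.prems by (simp add: Suc.IH)
    show ?thesis by (simp only: mult.assoc 2[symmetric]) (simp only: mult.assoc[symmetric] 1)
  qed
  then show ?case by (simp add: sum_distrib_left sum_distrib_right)
qed

text \<open>When two coproduct sums are multiplied, the summands do not match one by one; only the
  sum of those at \<open>(k, m)\<close> and \<open>(m, k)\<close> does.\<close>

lemma sum_square_cong:
  fixes f g :: "'i::linorder \<Rightarrow> 'i \<Rightarrow> 'b::ab_group_add"
  assumes "\<And>k. k \<in> S \<Longrightarrow> f k k = g k k"
    and "\<And>k m. k \<in> S \<Longrightarrow> m \<in> S \<Longrightarrow> k < m \<Longrightarrow> f k m + f m k = g k m + g m k"
  shows "(\<Sum>k\<in>S. \<Sum>m\<in>S. f k m) = (\<Sum>k\<in>S. \<Sum>m\<in>S. g k m)"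
proof (cases "finite S")
  case True
  have split: "(\<Sum>k\<in>S. \<Sum>m\<in>S. h k m) =
      (\<Sum>k\<in>S. h k k) + (\<Sum>k\<in>S. \<Sum>m\<in>{m\<in>S. k < m}. h k m + h m k)"
    for h :: "'i \<Rightarrow> 'i \<Rightarrow> 'b"
  proof -
    have *: "(\<Sum>m\<in>S. h k m) = h k k + ((\<Sum>m\<in>{m\<in>S. k < m}. h k m) + (\<Sum>m\<in>{m\<in>S. m < k}. h k m))"
      if "k \<in> S" for k
    proof -
      have "S = insert k ({m\<in>S. k < m} \<union> {m\<in>S. m < k})" using that by auto
      then have "sum (h k) S = sum (h k) (insert k ({m\<in>S. k < m} \<union> {m\<in>S. m < k}))" by simp
      also have "\<dots> = h k k + ((\<Sum>m\<in>{m\<in>S. k < m}. h k m) + (\<Sum>m\<in>{m\<in>S. m < k}. h k m))"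
        using True by (subst sum.insert) (auto intro!: sum.union_disjoint)
      finally show ?thesis .
    qed
    have "(\<Sum>k\<in>S. \<Sum>m\<in>{m\<in>S. m < k}. h k m) = (\<Sum>m\<in>S. \<Sum>k\<in>{k\<in>S. m < k}. h k m)"
      by (rule sum.swap_restrict[OF True True])
    then show ?thesis by (simp add: * sum.distrib)
  qed
  show ?thesis
    unfolding split using assms by (auto intro!: sum.cong arg_cong2[of _ _ _ _ "(+)"])
qed auto

text \<open>The step matrices satisfy the defining relations, and so do products of commuting
  matrices that satisfy them: this is the coproduct of the quantized matrix algebra.\<close>

lemma coproduct_same_row:
  fixes y z :: "nat \<Rightarrow> ('e, 'k::field) linop" and z' :: "nat \<Rightarrow> ('e, 'k::field) linop"
  assumes y: "\<And>k m. k \<in> S \<Longrightarrow> m \<in> S \<Longrightarrow> y k * y m = y m * y k"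
    and z: "\<And>k. k \<in> S \<Longrightarrow> z k * z' k = z' k * z k"
    and zz: "\<And>k m. k \<in> S \<Longrightarrow> m \<in> S \<Longrightarrow> k < m \<Longrightarrow>
          z k * z' m + z m * z' k = z' m * z k + z' k * z m"
    and c: "\<And>k m. k \<in> S \<Longrightarrow> m \<in> S \<Longrightarrow> y k * z m = z m * y k" "\<And>k m. k \<in> S \<Longrightarrow> m \<in> S \<Longrightarrow> y k * z' m = z' m * y k"
  shows "(\<Sum>k\<in>S. z k * y k) * (\<Sum>m\<in>S. z' m * y m) = (\<Sum>m\<in>S. z' m * y m) * (\<Sum>k\<in>S. z k * y k)"
proof -
  have 1: "z k * y k * (z' m * y m) = z k * z' m * (y k * y m)" if "k \<in> S" "m \<in> S" for k m
    using c that by (metis mult.assoc)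
  have 2: "z' k * y k * (z m * y m) = z' k * z m * (y k * y m)" if "k \<in> S" "m \<in> S" for k m
    using c that by (metis mult.assoc)
  have "(\<Sum>k\<in>S. \<Sum>m\<in>S. z k * y k * (z' m * y m)) = (\<Sum>k\<in>S. \<Sum>m\<in>S. z' k * y k * (z m * y m))"
  proof (rule sum_square_cong)
    fix k m assume km: "k \<in> S" "m \<in> S" "k < m"
    have "(z k * z' m + z m * z' k) * (y k * y m) = (z' m * z k + z' k * z m) * (y k * y m)"
      using zz[OF km] by simp
    then show "z k * y k * (z' m * y m) + z m * y m * (z' k * y k) =
       z' k * y k * (z m * y m) + z' m * y m * (z k * y k)"
      using km by (simp add: 1 2 y[of m k] distrib_right add.commute)
  qed (simp add: 1 2 z)
  then show ?thesis by (simp add: sum_product)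
qed

lemma dd_op_commute: "dd_op q n s d j * dd_op q n s d t = dd_op q n s d t * dd_op q n s d j"
proof (induction d arbitrary: s j t)
  case 0
  then show ?case by (simp add: dd_step_commute)
next
  case (Suc d)
  \<comment> \<open>For \<open>j < t\<close>, write \<open>z_k j\<close> for
    \<open>dd_step q s k j\<close>: both sides reduce to
    \<open>z_k j * z_m t + q (z_k t * z_m j)\<close>. The case \<open>t < j\<close> is the mirror
    image.\<close>
  have aux: "dd_step q s k j * dd_step q s m t + dd_step q s m j * dd_step q s k t =
      dd_step q s m t * dd_step q s k j + dd_step q s k t * dd_step q s m j" if "k < m" for k m
    using dd_step_less[OF that, of q s j t] dd_step_less[OF that, of q s t j]
    by (auto simp: op_scale_simps not_le split: if_splits)
  show ?case
    unfolding dd_op.simps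
    by (rule coproduct_same_row)
      (simp_all add: Suc.IH dd_step_commute aux dd_step_dd_op_commute)
qed

text \<open>All \<open>y\<close> are moved to the right of all \<open>z\<close> and brought into the
  order \<open>y' * y\<close> by their own relations. For \<open>k < m\<close> it remains to compare
  the coefficients of \<open>y' m * y k\<close> and of \<open>y' k * y m\<close>, and these agree by
  the relations of \<open>z\<close>.\<close>

lemma coproduct_less:
  fixes y y' :: "nat \<Rightarrow> ('e, 'k::field) linop" and z :: "nat \<Rightarrow> nat \<Rightarrow> ('e, 'k) linop"
  assumes y: "\<And>k m. k \<in> S \<Longrightarrow> m \<in> S \<Longrightarrow> y k * y' m =
      (if k \<le> m then q \<star> (y' m * y k) else y' m * y k + (q - 1) \<star> (y' k * y m))"
    and z_same: "\<And>k j t. k \<in> S \<Longrightarrow> z k j * z k t = z k t * z k j"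
    and z_less: "\<And>k m j t. k \<in> S \<Longrightarrow> m \<in> S \<Longrightarrow> k < m \<Longrightarrow> z m j * z k t =
      (if j \<le> t then q \<star> (z k t * z m j) else z k t * z m j + (q - 1) \<star> (z k j * z m t))"
    and c: "\<And>k m t. k \<in> S \<Longrightarrow> m \<in> S \<Longrightarrow> y k * z m t = z m t * y k"
    and c': "\<And>k m t. k \<in> S \<Longrightarrow> m \<in> S \<Longrightarrow> y' k * z m t = z m t * y' k"
  shows "(\<Sum>k\<in>S. z k j * y k) * (\<Sum>m\<in>S. z m t * y' m) =
    (if j \<le> t then q \<star> ((\<Sum>m\<in>S. z m t * y' m) * (\<Sum>k\<in>S. z k j * y k))
     else (\<Sum>m\<in>S. z m t * y' m) * (\<Sum>k\<in>S. z k j * y k) +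
       (q - 1) \<star> ((\<Sum>m\<in>S. z m j * y' m) * (\<Sum>k\<in>S. z k t * y k)))"
proof -
  have 1: "z k i * y k * (z m l * y' m) = z k i * z m l * (y k * y' m)" if "k \<in> S" "m \<in> S" for k m i l
    using c[OF that, of l] by (simp only: mult.assoc) (simp only: mult.assoc[symmetric])
  have 2: "z m l * y' m * (z k i * y k) = z m l * z k i * (y' m * y k)" if "k \<in> S" "m \<in> S" for k m i l
    using c'[OF that(2,1), of i] by (simp only: mult.assoc) (simp only: mult.assoc[symmetric])
  have swap: "(\<Sum>m\<in>S. z m i * y' m) * (\<Sum>k\<in>S. z k l * y k) =
      (\<Sum>k\<in>S. \<Sum>m\<in>S. z m i * z k l * (y' m * y k))" for i l
    by (subst sum_product, subst sum.swap) (auto intro!: sum.cong simp: 2)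
  have lhs: "(\<Sum>k\<in>S. z k j * y k) * (\<Sum>m\<in>S. z m t * y' m) =
      (\<Sum>k\<in>S. \<Sum>m\<in>S. z k j * z m t * (y k * y' m))"
    by (auto intro!: sum.cong simp: 1 sum_product)
  show ?thesis
  proof (cases "j \<le> t")
    case True
    have "(\<Sum>k\<in>S. \<Sum>m\<in>S. z k j * z m t * (y k * y' m)) =
        (\<Sum>k\<in>S. \<Sum>m\<in>S. q \<star> (z m t * z k j * (y' m * y k)))"
    proof (rule sum_square_cong)
      fix k m assume km: "k \<in> S" "m \<in> S" "k < m"
      have "z m j * z k t = q \<star> (z k t * z m j)"
        using km True by (simp add: z_less)
      \<comment> \<open>The coefficient of \<open>y' m * y k\<close>: besides
        \<open>y k * y' m\<close>, the product \<open>y m * y' k\<close> contributes to it through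
        its correction term. The preceding equation is the one for
        \<open>y' k * y m\<close>.\<close>
      moreover have "q \<star> (z k j * z m t) + (q - 1) \<star> (z m j * z k t) = q \<star> (z m t * z k j)"
        using km True z_less[OF km, of j t] z_less[OF km, of t j]
        by (cases "j = t") (auto simp: op_scale_simps left_diff_distrib)
      from arg_cong[OF this, of "\<lambda>F. F * (y' m * y k)"]
      have "q \<star> (z k j * z m t * (y' m * y k)) + (q - 1) \<star> (z m j * z k t * (y' m * y k)) =
          q \<star> (z m t * z k j * (y' m * y k))"
        by (simp add: distrib_right)
      ultimately show "z k j * z m t * (y k * y' m) + z m j * z k t * (y m * y' k) =
          q \<star> (z m t * z k j * (y' m * y k)) + q \<star> (z k t * z m j * (y' k * y m))"
        using km by (simp add: y distrib_left op_scale_add add.assoc add.commute)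
    qed (simp add: y z_same[of _ j t])
    then show ?thesis
      using True by (simp add: lhs swap op_scale_sum)
  next
    case False
    have "(\<Sum>k\<in>S. \<Sum>m\<in>S. z k j * z m t * (y k * y' m)) =
        (\<Sum>k\<in>S. \<Sum>m\<in>S. z m t * z k j * (y' m * y k) + (q - 1) \<star> (z m j * z k t * (y' m * y k)))"
    proof (rule sum_square_cong)
      fix k m assume km: "k \<in> S" "m \<in> S" "k < m"
      have "z m j * z k t = z k t * z m j + (q - 1) \<star> (z k j * z m t)"
        "z m t * z k j = q \<star> (z k j * z m t)"
        using km False by (simp_all add: z_less)
      then show "z k j * z m t * (y k * y' m) + z m j * z k t * (y m * y' k) =
          z m t * z k j * (y' m * y k) + (q - 1) \<star> (z m j * z k t * (y' m * y k)) +
          (z k t * z m j * (y' k * y m) + (q - 1) \<star> (z k j * z m t * (y' k * y m)))"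
        using km by (simp add: y distrib_left distrib_right)
    qed (simp add: y z_same[of _ j t] op_scale_diff_left)
    then show ?thesis
      using False by (simp add: lhs swap op_scale_sum sum.distrib)
  qed
qed

text \<open>For \<open>d' = 0\<close> the lower row is \<open>X_s\<close> itself, and row
  \<open>k\<close> of the step matrix against its row 0 suffices. Otherwise both rows share the
  factor \<open>Z_s\<close>, and the coproduct carries the relation over from row
  \<open>Suc s\<close>.\<close>

lemma dd_op_less:
  assumes "d' < d"
  shows "dd_op q n s d j * dd_op q n s d' t =
    (if j \<le> t then q \<star> (dd_op q n s d' t * dd_op q n s d j)
     else dd_op q n s d' t * dd_op q n s d j + (q - 1) \<star> (dd_op q n s d' j * dd_op q n s d t))"
  using assms
proof (induction d' arbitrary: d s j t)
  case 0
  then obtain e where d: "d = Suc e" using gr0_implies_Suc by blast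
  let ?y = "dd_op q n (Suc s) e"
  have c: "dd_step q s k i * ?y k * dd_step q s 0 l = dd_step q s k i * dd_step q s 0 l * ?y k" for k i l
    using dd_step_dd_op_commute[of s "Suc s" q 0 l n e k] by (simp add: mult.assoc)
  have "dd_step q s k j * ?y k * dd_step q s 0 t =
     (if j \<le> t then q \<star> (dd_step q s 0 t * (dd_step q s k j * ?y k))
     else dd_step q s 0 t * (dd_step q s k j * ?y k) + (q - 1) \<star> (dd_step q s 0 j * (dd_step q s k t * ?y k)))"
    if "k \<in> {1..n}" for k
  proof -
    have k: "0 < k" using that by simp
    show ?thesis by (simp only: c dd_step_less[OF k]) (simp add: distrib_right mult.assoc)
  qed
  then show ?case
    by (auto simp: d sum_distrib_left sum_distrib_right op_scale_sum sum.distrib)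
next
  case (Suc d')
  then obtain e where d: "d = Suc e" "d' < e" by (metis Suc_lessE)
  show ?case
    unfolding d(1) dd_op.simps
    by (rule coproduct_less)
      (simp_all only: Suc.IH[OF d(2)] dd_step_commute dd_step_less dd_step_dd_op_commute lessI)
qed

section \<open>Action on unit vectors\<close>

definition delta :: "'e \<Rightarrow> 'e \<Rightarrow> 'k::field" where
  "delta M = (\<lambda>N. if N = M then 1 else 0)"

lemma op_apply_simps:
  "op_apply (F * G) f = op_apply F (op_apply G f)"
  "op_apply (F + G) f = (\<lambda>x. op_apply F f x + op_apply G f x)"
  "op_apply (c \<star> F) f = (\<lambda>x. c * op_apply F f x)"
  "op_apply 0 f = (\<lambda>x. 0)" "op_apply 1 f = f"
  by (transfer; simp)+

lemma op_apply_sum: "op_apply (sum F S) f = (\<lambda>x. \<Sum>i\<in>S. op_apply (F i) f x)"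
  by (induction S rule: infinite_finite_induct) (simp_all add: op_apply_simps)

lemma dd_step_0_delta: "op_apply (dd_step q s 0 j) (delta M) = delta (add_mset (s, j) M)"
  unfolding dd_step_def if_P[OF refl]
  by transfer (auto simp: delta_def fun_eq_iff dest!: multi_member_split)

lemma op_apply_scale: "op_apply F (\<lambda>x. c * f x) = (\<lambda>x. c * op_apply F f x)"
  by transfer blast

lemma op_apply_zero [simp]: "op_apply F (\<lambda>x. 0) = (\<lambda>x. 0)"
  using op_apply_scale[of F 0 "\<lambda>x. 0"] by simp

text \<open>If row \<open>s\<close> is empty, every \<open>Q_j\<close> acts as 1 and no
  \<open>A_k\<close> finds an entry to remove, so the matrix of row \<open>s\<close> acts as the
  identity matrix.\<close>

lemma dd_step_delta:
  assumes "0 < k" "\<And>e. e \<in># M \<Longrightarrow> fst e \<noteq> s"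
  shows "op_apply (dd_step q s k j) (delta M) = (if k = j then delta M else (\<lambda>_. 0))"
proof -
  have "op_apply (opQ q s j) (delta M) = delta M"
    using tail_empty_row[of M s] assms(2) by transfer (auto simp: delta_def fun_eq_iff)
  moreover have "op_apply (opA q s k) (delta M) = (\<lambda>_. 0)"
    using assms(2) by transfer (fastforce simp: delta_def fun_eq_iff)
  ultimately show ?thesis
    using assms(1) by (simp add: dd_step_def op_apply_simps)
qed

text \<open>The matrices of rows \<open>s\<close> to \<open>s + d - 1\<close> act as identities
  here, so each sum keeps only its diagonal term and the final \<open>X_j\<close> inserts the new
  pair.\<close>

lemma dd_op_delta:
  assumes "j \<in> {1..n}" "\<And>e. e \<in># M \<Longrightarrow> s + d \<le> fst e"
  shows "op_apply (dd_op q n s d j) (delta M) = delta (add_mset (s + d, j) M)"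
  using assms
proof (induction d arbitrary: s j)
  case 0
  then show ?case by (simp add: dd_step_0_delta)
next
  case (Suc d)
  let ?M = "\<lambda>k. add_mset (Suc (s + d), k) M"
  have "op_apply (dd_step q s k j * dd_op q n (Suc s) d k) (delta M) x =
      (if k = j then delta (?M j) x else 0)" if "k \<in> {1..n}" for k x
  proof -
    have "op_apply (dd_op q n (Suc s) d k) (delta M) = delta (?M k)"
      using Suc.IH[of k "Suc s"] Suc.prems that by simp
    moreover have "fst e \<noteq> s" if "e \<in># ?M k" for e
      using that Suc.prems(2)[of e] by (cases e) auto
    ultimately show ?thesis
      using that dd_step_delta[of k "?M k" s q j] by (simp add: op_apply_simps)
  qed
  then show ?case
    using Suc.prems(1) by (simp add: op_apply_sum fun_eq_iff)
qed

text \<open>The leftmost letter acts last, on a multiset whose rows are all at least its own;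
  sorting by row number is enough for this, since letters of one row only multiply by the
  \<open>X_j\<close> of that row.\<close>

lemma dd_op_word_delta:
  assumes "sorted (map fst w)" "\<And>e. e \<in> set w \<Longrightarrow> snd e \<in> {1..n}"
  shows "op_apply (prod_list (map (\<lambda>(i, j). dd_op q n 0 i j) w)) (delta {#}) = delta (mset w)"
  using assms
proof (induction w)
  case Nil
  then show ?case by (simp add: op_apply_simps)
next
  case (Cons e w)
  obtain i j where e: "e = (i, j)" by fastforce
  have IH: "op_apply (prod_list (map (\<lambda>(i, j). dd_op q n 0 i j) w)) (delta {#}) = delta (mset w)"
    using Cons by simp
  have "j \<in> {1..n}" using Cons.prems(2)[of e] e by simp
  then have "op_apply (dd_op q n 0 i j) (delta (mset w)) = delta (add_mset (0 + i, j) (mset w))"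
    using Cons.prems by (intro dd_op_delta) (auto simp: e)
  then show ?case
    by (simp add: e op_apply_simps IH)
qed

section \<open>Operators as representations of the free algebra\<close>

text \<open>The homomorphism that the universal property of the free algebra attaches to
  \<open>D\<close>.\<close>

definition lift_op :: "('g \<Rightarrow> ('e, 'k::field) linop) \<Rightarrow> ('g word \<Rightarrow>\<^sub>0 'k) \<Rightarrow> ('e, 'k) linop" where
  "lift_op D p = (\<Sum>w\<in>Poly_Mapping.keys p. Poly_Mapping.lookup p w \<star> prod_list (map D (letters w)))"

lemma lift_op_superset:
  "finite S \<Longrightarrow> Poly_Mapping.keys p \<subseteq> S \<Longrightarrow>
    lift_op D p = (\<Sum>w\<in>S. Poly_Mapping.lookup p w \<star> prod_list (map D (letters w)))"
  unfolding lift_op_def by (rule sum.mono_neutral_left) (auto simp: in_keys_iff)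

lemma lift_op_0 [simp]: "lift_op D 0 = 0"
  by (simp add: lift_op_def)

lemma lift_op_add: "lift_op D (p + r) = lift_op D p + lift_op D r"
proof -
  let ?S = "Poly_Mapping.keys p \<union> Poly_Mapping.keys r"
  have "Poly_Mapping.keys (p + r) \<subseteq> ?S" by (rule keys_add)
  then show ?thesis
    by (simp add: lift_op_superset[of ?S] lookup_add op_scale_add_left sum.distrib)
qed

lemma lift_op_single: "lift_op D (Poly_Mapping.single w c) = c \<star> prod_list (map D (letters w))"
  by (cases "c = 0") (simp_all add: lift_op_def)

lemma poly_mapping_additive_induct [case_names zero single add]:
  assumes "P 0" "\<And>k v. P (Poly_Mapping.single k v)" "\<And>f g. P f \<Longrightarrow> P g \<Longrightarrow> P (f + g)"
  shows "P (f :: 'a \<Rightarrow>\<^sub>0 'b::comm_monoid_add)"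
proof (induction f rule: update_induct)
  case (update f a b)
  have "Poly_Mapping.update a b f = f + Poly_Mapping.single a b"
    using update by (intro poly_mapping_eqI) (auto simp: lookup_update lookup_add lookup_single in_keys_iff)
  then show ?case using assms update by simp
qed (rule assms)

lemma lift_op_mult: "lift_op D (p * r) = lift_op D p * lift_op D r"
proof -
  have single_single: "lift_op D (Poly_Mapping.single u a * Poly_Mapping.single v b) =
      lift_op D (Poly_Mapping.single u a) * lift_op D (Poly_Mapping.single v b)" for u v a b
    by (simp add: mult_single lift_op_single plus_word_def ac_simps)
  have single_left: "lift_op D (Poly_Mapping.single u a * r) = lift_op D (Poly_Mapping.single u a) * lift_op D r"
    for u a r
  proof (induction r rule: poly_mapping_additive_induct)
    case (single k v)
    then show ?case by (rule single_single)
  next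
    case (add f g)
    then show ?case by (simp add: distrib_left lift_op_add)
  qed simp
  show ?thesis
  proof (induction p rule: poly_mapping_additive_induct)
    case (single k v)
    then show ?case by (rule single_left)
  next
    case (add f g)
    then show ?case by (simp add: distrib_right lift_op_add)
  qed simp
qed

section \<open>Free algebras and their quotients\<close>

abbreviation scalars :: "'k::field ring" where
  "scalars \<equiv> ring_of_type_algebra"

lemma scalars_simps [simp]:
  "carrier scalars = UNIV" "monoid.mult scalars = (*)" "add scalars = (+)"
  "one scalars = 1" "ring.zero scalars = 0"
  by (simp_all add: ring_of_type_algebra_def)

lemma free_algebra_simps [simp]:
  "monoid.mult (free_algebra L) = (*)" "one (free_algebra L) = 1" "ring.zero (free_algebra L) = 0"
  "add (free_algebra L) = (+)" "c \<odot>\<^bsub>free_algebra L\<^esub> p = scalar c * p"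
  by (simp_all add: free_algebra_def)

lemma carrier_free_algebra:
  "p \<in> carrier (free_algebra L) \<longleftrightarrow> (\<forall>w\<in>Poly_Mapping.keys p. set (letters w) \<subseteq> L)"
  by (simp add: free_algebra_def)

lemma free_algebra_add_closed:
  "p \<in> carrier (free_algebra L) \<Longrightarrow> r \<in> carrier (free_algebra L) \<Longrightarrow> p + r \<in> carrier (free_algebra L)"
  unfolding carrier_free_algebra using keys_add[of p r] by blast

lemma free_algebra_mult_closed:
  "p \<in> carrier (free_algebra L) \<Longrightarrow> r \<in> carrier (free_algebra L) \<Longrightarrow> p * r \<in> carrier (free_algebra L)"
  unfolding carrier_free_algebra using keys_mult[of p r] by (fastforce simp: plus_word_def)

lemma free_algebra_zero_closed: "0 \<in> carrier (free_algebra L)"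
  by (simp add: carrier_free_algebra)

lemma free_algebra_one_closed: "1 \<in> carrier (free_algebra L)"
  by (simp add: carrier_free_algebra zero_word_def)

lemma free_algebra_uminus_closed:
  "p \<in> carrier (free_algebra L) \<Longrightarrow> - p \<in> carrier (free_algebra L)"
  unfolding carrier_free_algebra by (simp add: in_keys_iff)

lemma free_algebra_single_closed:
  "set (letters w) \<subseteq> L \<Longrightarrow> Poly_Mapping.single w c \<in> carrier (free_algebra L)"
  by (simp add: carrier_free_algebra)

lemma free_algebra_scalar_closed: "scalar c \<in> carrier (free_algebra L)"
  unfolding scalar_def by (rule free_algebra_single_closed) (simp add: zero_word_def)

lemma free_algebra_gen_closed: "g \<in> L \<Longrightarrow> free_gen g \<in> carrier (free_algebra L)"
  unfolding free_gen_def by (rule free_algebra_single_closed) simp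

lemma scalar_commute: "p * scalar c = scalar c * p"
proof (induction p rule: poly_mapping_additive_induct)
  case (single k v)
  then show ?case by (simp add: scalar_def mult_single mult.commute)
qed (simp_all add: distrib_left distrib_right)

lemma scalar_left_commute: "p * (scalar c * r) = scalar c * (p * r)"
  by (simp add: scalar_commute flip: mult.assoc)

lemma scalar_add: "scalar (c + d) = scalar c + scalar d"
  by (simp add: scalar_def single_add)

lemma scalar_mult: "scalar (c * d) = scalar c * scalar d"
  by (simp add: scalar_def mult_single)

lemma ring_free_algebra: "ring (free_algebra L)"
proof (rule ringI)
  show "abelian_group (free_algebra L)"
  proof (rule abelian_groupI)
    fix p assume "p \<in> carrier (free_algebra L)"
    then show "\<exists>r\<in>carrier (free_algebra L). r \<oplus>\<^bsub>free_algebra L\<^esub> p = \<zero>\<^bsub>free_algebra L\<^esub>"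
      by (intro bexI[of _ "- p"] free_algebra_uminus_closed) simp_all
  qed (simp_all add: free_algebra_add_closed ac_simps free_algebra_zero_closed)
  show "Group.monoid (free_algebra L)"
    by (rule monoidI) (simp_all add: free_algebra_mult_closed mult.assoc free_algebra_one_closed)
qed (simp_all add: distrib_left distrib_right)

lemma assoc_algebra_free_algebra: "assoc_algebra (scalars :: 'k::field ring) (free_algebra L)"
proof (intro assoc_algebra.intro moduleI ring_free_algebra assoc_algebra_axioms.intro)
  show "cring (scalars :: 'k ring)" by (rule cring_from_type_algebra)
  show "abelian_group (free_algebra L)" by (rule ring.is_abelian_group[OF ring_free_algebra])
  show "\<one>\<^bsub>scalars\<^esub> \<odot>\<^bsub>free_algebra L\<^esub> p = p" for p
    by (simp add: scalar_def)
  show "p \<otimes>\<^bsub>free_algebra L\<^esub> (c \<odot>\<^bsub>free_algebra L\<^esub> r) = c \<odot>\<^bsub>free_algebra L\<^esub> (p \<otimes>\<^bsub>free_algebra L\<^esub> r)" for c p r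
    by (simp add: scalar_left_commute)
qed (simp_all add: scalar_add scalar_mult distrib_left distrib_right mult.assoc
    free_algebra_mult_closed free_algebra_scalar_closed)

lemma generates_free_algebra:
  "generates_algebra (free_algebra L :: ('k::field, 'g word \<Rightarrow>\<^sub>0 'k) module) (free_gen ` L)"
  unfolding generates_algebra_def
proof (intro conjI allI impI)
  show "free_gen ` L \<subseteq> carrier (free_algebra L)" by (auto intro: free_algebra_gen_closed)
next
  fix S :: "('g word \<Rightarrow>\<^sub>0 'k) set"
  assume S: "S \<subseteq> carrier (free_algebra L)"
    and closed: "free_gen ` L \<subseteq> S \<and> \<one>\<^bsub>free_algebra L :: ('k, 'g word \<Rightarrow>\<^sub>0 'k) module\<^esub> \<in> S \<and>
      (\<forall>x\<in>S. \<forall>y\<in>S. x \<oplus>\<^bsub>free_algebra L :: ('k, 'g word \<Rightarrow>\<^sub>0 'k) module\<^esub> y \<in> S \<and>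
        x \<otimes>\<^bsub>free_algebra L :: ('k, 'g word \<Rightarrow>\<^sub>0 'k) module\<^esub> y \<in> S) \<and>
      (\<forall>c. \<forall>x\<in>S. c \<odot>\<^bsub>free_algebra L :: ('k, 'g word \<Rightarrow>\<^sub>0 'k) module\<^esub> x \<in> S)"
  have word: "Poly_Mapping.single (Word u) 1 \<in> S" if "set u \<subseteq> L" for u
    using that
  proof (induction u)
    case Nil
    then show ?case using closed by (simp flip: single_one add: zero_word_def)
  next
    case (Cons g u)
    have "Poly_Mapping.single (Word (g # u)) (1::'k) = free_gen g * Poly_Mapping.single (Word u) 1"
      by (simp add: free_gen_def mult_single plus_word_def)
    then show ?case using closed Cons by (auto simp: image_subset_iff)
  qed
  have "p \<in> carrier (free_algebra L) \<longrightarrow> p \<in> S" for p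
  proof (induction p rule: update_induct)
    case const
    have "scalar 0 * 1 \<in> S" using closed by (metis free_algebra_simps(2,5))
    then show ?case by (simp add: scalar_def)
  next
    case (update f a b)
    have eq: "Poly_Mapping.update a b f = f + scalar b * Poly_Mapping.single a 1"
      using update by (intro poly_mapping_eqI)
        (auto simp: lookup_update lookup_add lookup_single in_keys_iff scalar_def mult_single)
    show ?case
    proof
      assume u: "Poly_Mapping.update a b f \<in> carrier (free_algebra L)"
      have "Poly_Mapping.keys (Poly_Mapping.update a b f) = insert a (Poly_Mapping.keys f)"
        using update by (simp add: keys_update)
      then have "f \<in> S" "set (letters a) \<subseteq> L"
        using u update by (simp_all add: carrier_free_algebra)
      then show "Poly_Mapping.update a b f \<in> S"
        unfolding eq using closed word[of "letters a"] by simp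
    qed
  qed
  then show "S = carrier (free_algebra L)" using S by blast
qed

text \<open>Each axiom is an identity in representatives, pushed forward along \<open>h\<close>.
  Applied to the map onto cosets, it spares any computation with cosets as sets.\<close>

lemma assoc_algebra_surj_image:
  fixes A :: "('k::field, 'a) module" and B :: "('k, 'b) module"
  assumes A: "assoc_algebra scalars A"
    and surj: "carrier B = h ` carrier A"
    and add: "\<And>x y. x \<in> carrier A \<Longrightarrow> y \<in> carrier A \<Longrightarrow> h (x \<oplus>\<^bsub>A\<^esub> y) = h x \<oplus>\<^bsub>B\<^esub> h y"
    and mult: "\<And>x y. x \<in> carrier A \<Longrightarrow> y \<in> carrier A \<Longrightarrow> h (x \<otimes>\<^bsub>A\<^esub> y) = h x \<otimes>\<^bsub>B\<^esub> h y"
    and smult: "\<And>c x. x \<in> carrier A \<Longrightarrow> h (c \<odot>\<^bsub>A\<^esub> x) = c \<odot>\<^bsub>B\<^esub> h x"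
    and zero: "h \<zero>\<^bsub>A\<^esub> = \<zero>\<^bsub>B\<^esub>" and one: "h \<one>\<^bsub>A\<^esub> = \<one>\<^bsub>B\<^esub>"
  shows "assoc_algebra scalars B"
proof -
  interpret A: assoc_algebra scalars A by fact
  note hom = add[symmetric] mult[symmetric] smult[symmetric] zero[symmetric] one[symmetric]
  have [simp]: "c \<odot>\<^bsub>A\<^esub> x \<in> carrier A" if "x \<in> carrier A" for c x
    using that A.smult_closed by simp
  have abelian: "abelian_group B"
  proof (rule abelian_groupI)
    fix u assume "u \<in> carrier B"
    then obtain x where x: "u = h x" "x \<in> carrier A" using surj by auto
    show "\<exists>v\<in>carrier B. v \<oplus>\<^bsub>B\<^esub> u = \<zero>\<^bsub>B\<^esub>"
      by (rule bexI[of _ "h (\<ominus>\<^bsub>A\<^esub> x)"]) (use x in \<open>simp_all add: surj hom A.M.l_neg\<close>)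
  qed (auto simp: surj hom A.M.a_ac)
  show ?thesis
  proof (intro assoc_algebra.intro moduleI ringI monoidI assoc_algebra_axioms.intro abelian)
    show "cring (scalars :: 'k ring)" by (rule cring_from_type_algebra)
  qed (auto simp: surj hom A.m_assoc A.l_distr A.r_distr A.smult_assoc1 A.smult_l_distr[simplified]
      A.smult_r_distr A.smult_assoc1[simplified] A.smult_one[simplified] 
      A.smult_mult_left A.smult_mult_right)
qed

lemma generates_algebra_surj_image:
  fixes A :: "('k::field, 'a) module" and B :: "('k, 'b) module"
  assumes A: "assoc_algebra scalars A"
    and surj: "carrier B = h ` carrier A"
    and add: "\<And>x y. x \<in> carrier A \<Longrightarrow> y \<in> carrier A \<Longrightarrow> h (x \<oplus>\<^bsub>A\<^esub> y) = h x \<oplus>\<^bsub>B\<^esub> h y"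
    and mult: "\<And>x y. x \<in> carrier A \<Longrightarrow> y \<in> carrier A \<Longrightarrow> h (x \<otimes>\<^bsub>A\<^esub> y) = h x \<otimes>\<^bsub>B\<^esub> h y"
    and smult: "\<And>c x. x \<in> carrier A \<Longrightarrow> h (c \<odot>\<^bsub>A\<^esub> x) = c \<odot>\<^bsub>B\<^esub> h x"
    and one: "h \<one>\<^bsub>A\<^esub> = \<one>\<^bsub>B\<^esub>"
    and gen: "generates_algebra A G"
  shows "generates_algebra B (h ` G)"
  unfolding generates_algebra_def
proof (intro conjI allI impI)
  show "h ` G \<subseteq> carrier B" using gen surj by (auto simp: generates_algebra_def)
next
  interpret A: assoc_algebra scalars A by fact
  fix S assume S: "S \<subseteq> carrier B" and closed: "h ` G \<subseteq> S \<and> \<one>\<^bsub>B\<^esub> \<in> S \<and>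
    (\<forall>x\<in>S. \<forall>y\<in>S. x \<oplus>\<^bsub>B\<^esub> y \<in> S \<and> x \<otimes>\<^bsub>B\<^esub> y \<in> S) \<and> (\<forall>c. \<forall>x\<in>S. c \<odot>\<^bsub>B\<^esub> x \<in> S)"
  let ?T = "{x \<in> carrier A. h x \<in> S}"
  have gen': "T = carrier A" if "T \<subseteq> carrier A" "G \<subseteq> T" "\<one>\<^bsub>A\<^esub> \<in> T"
      "\<forall>x\<in>T. \<forall>y\<in>T. x \<oplus>\<^bsub>A\<^esub> y \<in> T \<and> x \<otimes>\<^bsub>A\<^esub> y \<in> T" "\<forall>c. \<forall>x\<in>T. c \<odot>\<^bsub>A\<^esub> x \<in> T" for T
    using gen that unfolding generates_algebra_def by blast
  have "?T = carrier A"
  proof (rule gen')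
    show "G \<subseteq> ?T" using gen closed by (auto simp: generates_algebra_def)
    show "\<forall>c. \<forall>x\<in>?T. c \<odot>\<^bsub>A\<^esub> x \<in> ?T"
      using closed A.smult_closed by (simp add: smult)
    show "\<forall>x\<in>?T. \<forall>y\<in>?T. x \<oplus>\<^bsub>A\<^esub> y \<in> ?T \<and> x \<otimes>\<^bsub>A\<^esub> y \<in> ?T"
      using closed by (simp add: add mult)
    show "\<one>\<^bsub>A\<^esub> \<in> ?T" using closed by (simp add: one)
  qed (rule Collect_restrict)
  then have "h ` carrier A \<subseteq> S" by auto
  then show "S = carrier B" using S surj by simp
qed

section \<open>Quotients by an ideal\<close>

context
  fixes A :: "('k::field, 'a) module" and I
  assumes A: "assoc_algebra scalars A" and I: "ideal I A"
begin

interpretation A: assoc_algebra scalars A by (rule A)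
interpretation I: ideal I A by (rule I)

lemma carrier_quotient_algebra: "carrier (quotient_algebra A I) = (\<lambda>x. I +>\<^bsub>A\<^esub> x) ` carrier A"
  by (auto simp: quotient_algebra_def FactRing_simps)

lemma quotient_algebra_add:
  "x \<in> carrier A \<Longrightarrow> y \<in> carrier A \<Longrightarrow>
    I +>\<^bsub>A\<^esub> (x \<oplus>\<^bsub>A\<^esub> y) = (I +>\<^bsub>A\<^esub> x) \<oplus>\<^bsub>quotient_algebra A I\<^esub> (I +>\<^bsub>A\<^esub> y)"
  by (simp add: quotient_algebra_def FactRing_simps I.a_rcos_sum)

lemma quotient_algebra_mult:
  "x \<in> carrier A \<Longrightarrow> y \<in> carrier A \<Longrightarrow>
    I +>\<^bsub>A\<^esub> (x \<otimes>\<^bsub>A\<^esub> y) = (I +>\<^bsub>A\<^esub> x) \<otimes>\<^bsub>quotient_algebra A I\<^esub> (I +>\<^bsub>A\<^esub> y)"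
  by (simp add: quotient_algebra_def FactRing_simps I.rcoset_mult_add)

lemma quotient_algebra_one: "I +>\<^bsub>A\<^esub> \<one>\<^bsub>A\<^esub> = \<one>\<^bsub>quotient_algebra A I\<^esub>"
  by (simp add: quotient_algebra_def FactRing_simps)

lemma quotient_algebra_zero: "I +>\<^bsub>A\<^esub> \<zero>\<^bsub>A\<^esub> = \<zero>\<^bsub>quotient_algebra A I\<^esub>"
  by (simp add: quotient_algebra_def FactRing_simps I.a_subset)

text \<open>The scalar multiple in the quotient is a union over all representatives. It is a single
  coset because \<open>c i = (c 1) i\<close> stays in the ideal for every \<open>i\<close> in
  it.\<close>

lemma quotient_algebra_smult:
  assumes x: "x \<in> carrier A"
  shows "I +>\<^bsub>A\<^esub> (c \<odot>\<^bsub>A\<^esub> x) = c \<odot>\<^bsub>quotient_algebra A I\<^esub> (I +>\<^bsub>A\<^esub> x)"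
proof -
  have "I +>\<^bsub>A\<^esub> (c \<odot>\<^bsub>A\<^esub> y) = I +>\<^bsub>A\<^esub> (c \<odot>\<^bsub>A\<^esub> x)" if y: "y \<in> I +>\<^bsub>A\<^esub> x" for y
  proof -
    obtain i where i: "i \<in> I" "y = i \<oplus>\<^bsub>A\<^esub> x" using y by (auto simp: a_r_coset_def')
    have "c \<odot>\<^bsub>A\<^esub> i = (c \<odot>\<^bsub>A\<^esub> \<one>\<^bsub>A\<^esub>) \<otimes>\<^bsub>A\<^esub> i"
      using i I.Icarr by (simp add: A.smult_mult_left)
    then have "c \<odot>\<^bsub>A\<^esub> i \<in> I" using i I.I_l_closed[of i "c \<odot>\<^bsub>A\<^esub> \<one>\<^bsub>A\<^esub>"] A.smult_closed by simp
    moreover have "c \<odot>\<^bsub>A\<^esub> y = c \<odot>\<^bsub>A\<^esub> i \<oplus>\<^bsub>A\<^esub> c \<odot>\<^bsub>A\<^esub> x"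
      using i x I.Icarr by (simp add: A.smult_r_distr)
    ultimately have "c \<odot>\<^bsub>A\<^esub> y \<in> I +>\<^bsub>A\<^esub> (c \<odot>\<^bsub>A\<^esub> x)"
      by (auto simp: a_r_coset_def')
    then show ?thesis
      using x A.smult_closed by (intro I.a_repr_independence'[symmetric]) auto
  qed
  moreover have "I +>\<^bsub>A\<^esub> x \<noteq> {}" using I.a_rcos_self[OF x] by blast
  ultimately have "(\<Union>y\<in>I +>\<^bsub>A\<^esub> x. I +>\<^bsub>A\<^esub> (c \<odot>\<^bsub>A\<^esub> y)) = I +>\<^bsub>A\<^esub> (c \<odot>\<^bsub>A\<^esub> x)"
    by (intro SUP_eq_const)
  then show ?thesis by (simp add: quotient_algebra_def)
qed

lemma assoc_algebra_quotient: "assoc_algebra scalars (quotient_algebra A I)"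
  by (rule assoc_algebra_surj_image[OF A carrier_quotient_algebra])
    (simp_all add: quotient_algebra_add quotient_algebra_mult quotient_algebra_smult
      quotient_algebra_zero quotient_algebra_one)

lemma generates_quotient:
  "generates_algebra A G \<Longrightarrow> generates_algebra (quotient_algebra A I) ((\<lambda>x. I +>\<^bsub>A\<^esub> x) ` G)"
  by (rule generates_algebra_surj_image[OF A carrier_quotient_algebra])
    (simp_all add: quotient_algebra_add quotient_algebra_mult quotient_algebra_smult quotient_algebra_one)

end

section \<open>Straightening\<close>

definition weight :: "('i \<Rightarrow> nat) \<Rightarrow> 'i multiset \<Rightarrow> nat" where
  "weight wt M = sum_mset (image_mset wt M)"

definition prec :: "('i::wellorder \<Rightarrow> nat) \<Rightarrow> 'i multiset \<Rightarrow> 'i multiset \<Rightarrow> bool" where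
  "prec wt M N \<longleftrightarrow> weight wt M < weight wt N \<or> weight wt M = weight wt N \<and> M < N"

lemma weight_simps [simp]:
  "weight wt {#} = 0" "weight wt (M + N) = weight wt M + weight wt N"
  "weight wt (add_mset x M) = wt x + weight wt M"
  by (simp_all add: weight_def)

lemma prec_irrefl [simp]: "\<not> prec wt M M"
  by (simp add: prec_def)

lemma prec_trans: "prec wt L M \<Longrightarrow> prec wt M N \<Longrightarrow> prec wt L N"
  unfolding prec_def by auto

lemma prec_linear: "prec wt M N \<or> M = N \<or> prec wt N M"
  unfolding prec_def by (metis linorder_neqE)

lemma prec_add_left: "prec wt (L + M) (L + N) \<longleftrightarrow> prec wt M N"
  by (simp add: prec_def)

lemma prec_add_right: "prec wt (M + L) (N + L) \<longleftrightarrow> prec wt M N"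
  by (simp add: prec_def)

lemma prec_add_nonempty: "L \<noteq> {#} \<Longrightarrow> prec wt M (M + L)"
  by (auto simp: prec_def)

lemma wf_prec: "wf {(M, N). prec wt M N}"
proof -
  have "{(M, N). prec wt M N} =
      inv_image (less_than <*lex*> {(M, N). M < N}) (\<lambda>M. (weight wt M, M))"
    by (auto simp: prec_def)
  then show ?thesis by (simp add: wf_lex_prod wf)
qed

lemma not_sorted_descent:
  fixes w :: "'i::linorder list"
  assumes "\<not> sorted w"
  obtains u i j v where "w = u @ j # i # v" "i < j"
proof -
  obtain k where k: "Suc k < length w" "w ! Suc k < w ! k"
    using assms by (auto simp: sorted_iff_nth_Suc not_le)
  then have "w = take k w @ w ! k # w ! Suc k # drop (Suc (Suc k)) w"
    by (metis Cons_nth_drop_Suc Suc_lessD append_take_drop_id)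
  then show ?thesis using k(2) that by blast
qed

lemma count_concat_replicate:
  "distinct xs \<Longrightarrow> count (mset (concat (map (\<lambda>i. replicate (f i) i) xs))) j =
    (if j \<in> set xs then f j else 0)"
  by (induction xs) auto

lemma sorted_concat_replicate:
  "sorted xs \<Longrightarrow> sorted (concat (map (\<lambda>i. replicate (f i) i) xs))"
  by (induction xs) (auto simp: sorted_append sorted_replicate)

text \<open>Linear combinations are built one term at a time, so closure properties follow by
  induction without handling coefficient functions.\<close>

inductive lin_span :: "('k::field, 'a) module \<Rightarrow> ('i \<Rightarrow> 'a) \<Rightarrow> 'i set \<Rightarrow> 'a \<Rightarrow> bool"
  for A b S where
  zero: "lin_span A b S \<zero>\<^bsub>A\<^esub>"
| step: "N \<in> S \<Longrightarrow> lin_span A b S x \<Longrightarrow> lin_span A b S (c \<odot>\<^bsub>A\<^esub> b N \<oplus>\<^bsub>A\<^esub> x)"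

definition word_prod :: "('k::field, 'a) module \<Rightarrow> 'a list \<Rightarrow> nat list \<Rightarrow> 'a" where
  "word_prod A as w = foldr (\<lambda>i x. as ! i \<otimes>\<^bsub>A\<^esub> x) w \<one>\<^bsub>A\<^esub>"

definition sorted_mon :: "('k::field, 'a) module \<Rightarrow> 'a list \<Rightarrow> nat multiset \<Rightarrow> 'a" where
  "sorted_mon A as N = word_prod A as (sorted_list_of_multiset N)"

text \<open>\<open>quasi_comm\<close> makes the sorted monomials span. Independence enters through
  \<open>coeff\<close>, a family of linear functionals dual to them, which a representation has to
  supply. If \<open>c = 0\<close>, then \<open>s\<close> and \<open>t\<close> are mere
  placeholders.\<close>

locale quasi_commuting = assoc_algebra "ring_of_type_algebra :: 'k::field ring" A
  for A :: "('k::field, 'a) module" +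
  fixes as :: "'a list" and wt :: "nat \<Rightarrow> nat" and coeff :: "'a \<Rightarrow> nat multiset \<Rightarrow> 'k::field"
  assumes generators: "generates_algebra A (set as)"
    and quasi_comm: "\<And>i j. i < j \<Longrightarrow> j < length as \<Longrightarrow> \<exists>l c s t. l \<noteq> 0 \<and> s \<le> t \<and> t < length as \<and>
        (c = 0 \<or> wt s + wt t < wt i + wt j) \<and>
        as ! j \<otimes>\<^bsub>A\<^esub> as ! i = l \<odot>\<^bsub>A\<^esub> (as ! i \<otimes>\<^bsub>A\<^esub> as ! j) \<oplus>\<^bsub>A\<^esub> c \<odot>\<^bsub>A\<^esub> (as ! s \<otimes>\<^bsub>A\<^esub> as ! t)"
    and coeff_add: "\<And>x y N. x \<in> carrier A \<Longrightarrow> y \<in> carrier A \<Longrightarrow> coeff (x \<oplus>\<^bsub>A\<^esub> y) N = coeff x N + coeff y N"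
    and coeff_smult: "\<And>c x N. x \<in> carrier A \<Longrightarrow> coeff (c \<odot>\<^bsub>A\<^esub> x) N = c * coeff x N"
    and coeff_mon: "\<And>M N. set_mset M \<subseteq> {..<length as} \<Longrightarrow> coeff (sorted_mon A as M) N = (if M = N then 1 else 0)"
begin

abbreviation "wprod \<equiv> word_prod A as"
abbreviation "pmon \<equiv> sorted_mon A as"
abbreviation "valid \<equiv> {N. set_mset N \<subseteq> {..<length as}}"
abbreviation "lower N \<equiv> {M \<in> valid. prec wt M N}"

lemma smult_carrier [simp, intro]: "x \<in> carrier A \<Longrightarrow> c \<odot>\<^bsub>A\<^esub> x \<in> carrier A"
  using smult_closed by simp

lemma smult_distrib: "x \<in> carrier A \<Longrightarrow> y \<in> carrier A \<Longrightarrow> c \<odot>\<^bsub>A\<^esub> (x \<oplus>\<^bsub>A\<^esub> y) = c \<odot>\<^bsub>A\<^esub> x \<oplus>\<^bsub>A\<^esub> c \<odot>\<^bsub>A\<^esub> y"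
  using smult_r_distr by simp

lemma smult_distrib_left: "x \<in> carrier A \<Longrightarrow> (c + d) \<odot>\<^bsub>A\<^esub> x = c \<odot>\<^bsub>A\<^esub> x \<oplus>\<^bsub>A\<^esub> d \<odot>\<^bsub>A\<^esub> x"
  using smult_l_distr[of c d x] by simp

lemma smult_smult: "x \<in> carrier A \<Longrightarrow> c \<odot>\<^bsub>A\<^esub> (d \<odot>\<^bsub>A\<^esub> x) = (c * d) \<odot>\<^bsub>A\<^esub> x"
  using smult_assoc1[of c d x] by simp

lemma smult_left: "x \<in> carrier A \<Longrightarrow> y \<in> carrier A \<Longrightarrow> (c \<odot>\<^bsub>A\<^esub> x) \<otimes>\<^bsub>A\<^esub> y = c \<odot>\<^bsub>A\<^esub> (x \<otimes>\<^bsub>A\<^esub> y)"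
  using smult_mult_left by simp

lemma smult_right: "x \<in> carrier A \<Longrightarrow> y \<in> carrier A \<Longrightarrow> x \<otimes>\<^bsub>A\<^esub> (c \<odot>\<^bsub>A\<^esub> y) = c \<odot>\<^bsub>A\<^esub> (x \<otimes>\<^bsub>A\<^esub> y)"
  using smult_mult_right by simp

lemma smult_1 [simp]: "x \<in> carrier A \<Longrightarrow> 1 \<odot>\<^bsub>A\<^esub> x = x"
  using smult_one by simp

lemma smult_0_left [simp]: "x \<in> carrier A \<Longrightarrow> 0 \<odot>\<^bsub>A\<^esub> x = \<zero>\<^bsub>A\<^esub>"
  using smult_l_null by simp

lemma smult_0_right [simp]: "c \<odot>\<^bsub>A\<^esub> \<zero>\<^bsub>A\<^esub> = \<zero>\<^bsub>A\<^esub>"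
  using smult_r_null by simp

lemma gen_closed [simp]: "i < length as \<Longrightarrow> as ! i \<in> carrier A"
  using generators by (auto simp: generates_algebra_def)

lemma wprod_Nil [simp]: "wprod [] = \<one>\<^bsub>A\<^esub>" and wprod_Cons [simp]: "wprod (i # w) = as ! i \<otimes>\<^bsub>A\<^esub> wprod w"
  by (simp_all add: word_prod_def)

lemma wprod_closed [simp]: "set w \<subseteq> {..<length as} \<Longrightarrow> wprod w \<in> carrier A"
  by (induction w) auto

lemma wprod_append:
  "set u \<subseteq> {..<length as} \<Longrightarrow> set v \<subseteq> {..<length as} \<Longrightarrow> wprod (u @ v) = wprod u \<otimes>\<^bsub>A\<^esub> wprod v"
  by (induction u) (auto simp: m_assoc)

lemma mon_closed [simp]: "set_mset N \<subseteq> {..<length as} \<Longrightarrow> pmon N \<in> carrier A"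
  by (simp add: sorted_mon_def)

lemma mon_mset_sorted: "sorted w \<Longrightarrow> pmon (mset w) = wprod w"
  by (simp add: sorted_mon_def sorted_sort_id)

abbreviation "mspan \<equiv> lin_span A pmon"

lemma mspan_closed: "mspan S x \<Longrightarrow> S \<subseteq> valid \<Longrightarrow> x \<in> carrier A"
  by (induction rule: lin_span.induct) auto

lemma mspan_mono: "mspan S x \<Longrightarrow> S \<subseteq> T \<Longrightarrow> mspan T x"
  by (induction rule: lin_span.induct) (auto intro: lin_span.intros)

lemma mspan_add:
  assumes "mspan S x" "mspan S y" "S \<subseteq> valid"
  shows "mspan S (x \<oplus>\<^bsub>A\<^esub> y)"
  using assms(1)
proof (induction rule: lin_span.induct)
  case zero
  then show ?case using assms mspan_closed by simp
next
  case (step N x c)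
  then have "c \<odot>\<^bsub>A\<^esub> pmon N \<oplus>\<^bsub>A\<^esub> x \<oplus>\<^bsub>A\<^esub> y = c \<odot>\<^bsub>A\<^esub> pmon N \<oplus>\<^bsub>A\<^esub> (x \<oplus>\<^bsub>A\<^esub> y)"
    using assms(2,3) mspan_closed by (intro a_assoc) auto
  then show ?case using lin_span.step[OF step(1,3)] by simp
qed

lemma mspan_smult:
  assumes "mspan S x" "S \<subseteq> valid"
  shows "mspan S (d \<odot>\<^bsub>A\<^esub> x)"
  using assms(1)
proof (induction rule: lin_span.induct)
  case zero
  then show ?case by (simp add: lin_span.zero)
next
  case (step N x c)
  then have "d \<odot>\<^bsub>A\<^esub> (c \<odot>\<^bsub>A\<^esub> pmon N \<oplus>\<^bsub>A\<^esub> x) = (d * c) \<odot>\<^bsub>A\<^esub> pmon N \<oplus>\<^bsub>A\<^esub> d \<odot>\<^bsub>A\<^esub> x"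
    using assms(2) mspan_closed[OF step(2)] by (subst smult_distrib) (auto simp: smult_smult)
  then show ?case using lin_span.step[OF step(1,3)] by simp
qed

text \<open>Rewriting a descent either decreases the content of a word in the order \<^const>\<open>prec\<close>, or keeps
  the content and decreases the word lexicographically.\<close>

lemma straighten:
  assumes "set w \<subseteq> {..<length as}"
  shows "\<exists>l r. l \<noteq> 0 \<and> mspan (lower (mset w)) r \<and> wprod w = l \<odot>\<^bsub>A\<^esub> pmon (mset w) \<oplus>\<^bsub>A\<^esub> r"
proof -
  \<comment> \<open>The plain lexicographic order on lists is not well-founded, but
    \<open>lenlex\<close> compares lengths before letters, and words with the same content have the
    same length.\<close>
  have "wf (inv_image ({(M, N). prec wt M N} <*lex*> lenlex less_than) (\<lambda>w. (mset w, w)))"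
    by (intro wf_inv_image wf_lex_prod wf_prec wf_lenlex wf_less_than)
  then show ?thesis using assms
  proof (induction w rule: wf_induct_rule)
    case (less w)
    show ?case
    proof (cases "sorted w")
      case True
      then show ?thesis
        using less.prems by (intro exI[of _ 1] exI[of _ "\<zero>\<^bsub>A\<^esub>"]) (simp add: mon_mset_sorted lin_span.zero)
    next
      case False
      then obtain u i j v where w: "w = u @ j # i # v" and ij: "i < j"
        by (rule not_sorted_descent)
      then have sets: "set u \<subseteq> {..<length as}" "set v \<subseteq> {..<length as}" "i < length as" "j < length as"
        using less.prems by auto
      obtain l c s t where l: "l \<noteq> 0" "s \<le> t" "t < length as" "c = 0 \<or> wt s + wt t < wt i + wt j"
        and rel: "as ! j \<otimes>\<^bsub>A\<^esub> as ! i = l \<odot>\<^bsub>A\<^esub> (as ! i \<otimes>\<^bsub>A\<^esub> as ! j) \<oplus>\<^bsub>A\<^esub> c \<odot>\<^bsub>A\<^esub> (as ! s \<otimes>\<^bsub>A\<^esub> as ! t)"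
        using quasi_comm[OF ij sets(4)] by blast
      let ?w1 = "u @ i # j # v" and ?w2 = "u @ s # t # v"
      have st: "s < length as" using l by simp
      have two: "wprod (u @ a # b # v) = wprod u \<otimes>\<^bsub>A\<^esub> ((as ! a \<otimes>\<^bsub>A\<^esub> as ! b) \<otimes>\<^bsub>A\<^esub> wprod v)"
        if "a < length as" "b < length as" for a b
        using that sets by (simp add: wprod_append m_assoc)
      have prod: "wprod w = l \<odot>\<^bsub>A\<^esub> wprod ?w1 \<oplus>\<^bsub>A\<^esub> c \<odot>\<^bsub>A\<^esub> wprod ?w2"
        using sets st l(3) by (simp add: w two rel l_distr r_distr smult_left smult_right)
      have "mset ?w1 = mset w" by (simp add: w)
      moreover have "(?w1, w) \<in> lenlex less_than"
        using ij by (auto simp: w lenlex_conv intro!: lex_append_leftI)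
      ultimately obtain l' r' where l': "l' \<noteq> 0" "mspan (lower (mset w)) r'"
          "wprod ?w1 = l' \<odot>\<^bsub>A\<^esub> pmon (mset w) \<oplus>\<^bsub>A\<^esub> r'"
        using less.IH[of ?w1] sets by force
      have "mspan (lower (mset w)) (c \<odot>\<^bsub>A\<^esub> wprod ?w2)"
      proof (cases "c = 0")
        case True
        then show ?thesis using sets st l(3) by (simp add: lin_span.zero)
      next
        case False
        then have prec: "prec wt (mset ?w2) (mset w)" using l(4) by (auto simp: w prec_def)
        then obtain l2 r2 where l2: "mspan (lower (mset ?w2)) r2"
            "wprod ?w2 = l2 \<odot>\<^bsub>A\<^esub> pmon (mset ?w2) \<oplus>\<^bsub>A\<^esub> r2"
          using less.IH[of ?w2] sets st l(3) by auto
        have "lower (mset ?w2) \<subseteq> lower (mset w)" using prec prec_trans by blast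
        then have "mspan (lower (mset w)) r2" using l2(1) mspan_mono by blast
        moreover have "mset ?w2 \<in> lower (mset w)" using prec sets st l(3) by auto
        ultimately have "mspan (lower (mset w)) (wprod ?w2)" unfolding l2(2) by (intro lin_span.step)
        then show ?thesis by (intro mspan_smult) auto
      qed
      moreover have "mspan (lower (mset w)) (l \<odot>\<^bsub>A\<^esub> r')" using l'(2) by (intro mspan_smult) auto
      ultimately have r: "mspan (lower (mset w)) (l \<odot>\<^bsub>A\<^esub> r' \<oplus>\<^bsub>A\<^esub> c \<odot>\<^bsub>A\<^esub> wprod ?w2)"
        by (intro mspan_add) auto
      have "r' \<in> carrier A" using l'(2) by (rule mspan_closed) auto
      then have "wprod w = (l * l') \<odot>\<^bsub>A\<^esub> pmon (mset w) \<oplus>\<^bsub>A\<^esub> (l \<odot>\<^bsub>A\<^esub> r' \<oplus>\<^bsub>A\<^esub> c \<odot>\<^bsub>A\<^esub> wprod ?w2)"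
        using sets st l(3) less.prems
        by (simp add: prod l'(3) smult_distrib smult_smult a_assoc del: wprod_Cons)
      moreover have "l * l' \<noteq> 0" using l(1) l'(1) by simp
      ultimately show ?thesis using r by (intro exI conjI)
    qed
  qed
qed

section \<open>The basis and its dual functionals\<close>

abbreviation "basis \<equiv> pmon ` valid"

lemma coeff_zero [simp]: "coeff \<zero>\<^bsub>A\<^esub> N = 0"
  using coeff_smult[of "\<zero>\<^bsub>A\<^esub>" 0 N] by simp

lemma coeff_mspan:
  assumes "mspan S x" "S \<subseteq> valid" "coeff x N \<noteq> 0"
  shows "N \<in> S"
  using assms(1,3)
proof (induction rule: lin_span.induct)
  case (step M x c)
  then have "set_mset M \<subseteq> {..<length as}" using assms(2) by auto
  then have "coeff (c \<odot>\<^bsub>A\<^esub> pmon M \<oplus>\<^bsub>A\<^esub> x) N = (if M = N then c else 0) + coeff x N"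
    using mspan_closed[OF step(2) assms(2)] by (simp add: coeff_add coeff_smult coeff_mon)
  then show ?case using step by (auto split: if_splits)
qed simp

lemma inj_mon: "inj_on pmon valid"
proof (rule inj_onI)
  fix M N assume "M \<in> valid" "N \<in> valid" "pmon M = pmon N"
  then show "M = N" using coeff_mon[of M N] coeff_mon[of N N] by (auto split: if_splits)
qed

lemma wprod_mspan: "set w \<subseteq> {..<length as} \<Longrightarrow> mspan valid (wprod w)"
proof -
  assume w: "set w \<subseteq> {..<length as}"
  then obtain l r where r: "mspan (lower (mset w)) r" "wprod w = l \<odot>\<^bsub>A\<^esub> pmon (mset w) \<oplus>\<^bsub>A\<^esub> r"
    using straighten by blast
  have "mspan valid r" using r(1) by (rule mspan_mono) auto
  then show ?thesis unfolding r(2) using w by (intro lin_span.step) auto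
qed

lemma mon_mult: "M \<in> valid \<Longrightarrow> N \<in> valid \<Longrightarrow>
    pmon M \<otimes>\<^bsub>A\<^esub> pmon N = wprod (sorted_list_of_multiset M @ sorted_list_of_multiset N)"
  by (simp add: sorted_mon_def wprod_append)

lemma mspan_mult_mon:
  assumes "mspan valid y" "M \<in> valid"
  shows "mspan valid (pmon M \<otimes>\<^bsub>A\<^esub> y)"
  using assms(1)
proof (induction rule: lin_span.induct)
  case zero
  then show ?case using assms(2) by (simp add: lin_span.zero)
next
  case (step N y c)
  have "y \<in> carrier A" using step(2) by (rule mspan_closed) auto
  then have "pmon M \<otimes>\<^bsub>A\<^esub> (c \<odot>\<^bsub>A\<^esub> pmon N \<oplus>\<^bsub>A\<^esub> y) = c \<odot>\<^bsub>A\<^esub> (pmon M \<otimes>\<^bsub>A\<^esub> pmon N) \<oplus>\<^bsub>A\<^esub> pmon M \<otimes>\<^bsub>A\<^esub> y"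
    using step(1) assms(2) by (simp add: r_distr smult_right)
  moreover have "mspan valid (pmon M \<otimes>\<^bsub>A\<^esub> pmon N)"
    using step(1) assms(2) unfolding mon_mult[OF assms(2) step(1)] by (intro wprod_mspan) auto
  ultimately show ?case using step(3) by (simp add: mspan_add mspan_smult)
qed

lemma mspan_mult:
  assumes "mspan valid x" "mspan valid y"
  shows "mspan valid (x \<otimes>\<^bsub>A\<^esub> y)"
  using assms(1)
proof (induction rule: lin_span.induct)
  case zero
  have "y \<in> carrier A" using assms(2) by (rule mspan_closed) auto
  then show ?case by (simp add: lin_span.zero)
next
  case (step N x c)
  have "y \<in> carrier A" using assms(2) by (rule mspan_closed) auto
  moreover have "x \<in> carrier A" using step(2) by (rule mspan_closed) auto
  ultimately have "(c \<odot>\<^bsub>A\<^esub> pmon N \<oplus>\<^bsub>A\<^esub> x) \<otimes>\<^bsub>A\<^esub> y = c \<odot>\<^bsub>A\<^esub> (pmon N \<otimes>\<^bsub>A\<^esub> y) \<oplus>\<^bsub>A\<^esub> x \<otimes>\<^bsub>A\<^esub> y"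
    using step(1) by (simp add: l_distr smult_left)
  then show ?case
    using step mspan_mult_mon[OF assms(2)] by (simp add: mspan_add mspan_smult)
qed

text \<open>The span contains the unit and the generators, and it is closed under multiplication
  because a concatenation of two sorted words can be straightened again.\<close>

lemma carrier_mspan: "x \<in> carrier A \<longleftrightarrow> mspan valid x"
proof -
  have "{x. mspan valid x} = carrier A"
  proof -
    have gen': "T = carrier A" if "T \<subseteq> carrier A" "set as \<subseteq> T" "\<one>\<^bsub>A\<^esub> \<in> T"
        "\<forall>x\<in>T. \<forall>y\<in>T. x \<oplus>\<^bsub>A\<^esub> y \<in> T \<and> x \<otimes>\<^bsub>A\<^esub> y \<in> T" "\<forall>c. \<forall>x\<in>T. c \<odot>\<^bsub>A\<^esub> x \<in> T" for T
      using generators that unfolding generates_algebra_def by blast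
    show ?thesis
    proof (rule gen')
      show "{x. mspan valid x} \<subseteq> carrier A" using mspan_closed by blast
      show "set as \<subseteq> {x. mspan valid x}"
      proof
        fix a assume "a \<in> set as"
        then obtain i where "i < length as" "a = as ! i" by (auto simp: in_set_conv_nth)
        then show "a \<in> {x. mspan valid x}" using wprod_mspan[of "[i]"] by simp
      qed
      show "\<one>\<^bsub>A\<^esub> \<in> {x. mspan valid x}" using wprod_mspan[of "[]"] by simp
      show "\<forall>x\<in>{x. mspan valid x}. \<forall>y\<in>{x. mspan valid x}.
          x \<oplus>\<^bsub>A\<^esub> y \<in> {x. mspan valid x} \<and> x \<otimes>\<^bsub>A\<^esub> y \<in> {x. mspan valid x}"
        by (simp add: mspan_add mspan_mult)
      show "\<forall>c. \<forall>x\<in>{x. mspan valid x}. c \<odot>\<^bsub>A\<^esub> x \<in> {x. mspan valid x}"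
        by (simp add: mspan_smult)
    qed
  qed
  then show ?thesis by blast
qed

lemma basis_carrier: "basis \<subseteq> carrier A"
  by auto

lemma lin_comb_superset:
  assumes "finite F" "Poly_Mapping.keys c \<subseteq> F" "F \<subseteq> carrier A"
  shows "lin_comb A c = (\<Oplus>\<^bsub>A\<^esub>b\<in>F. Poly_Mapping.lookup c b \<odot>\<^bsub>A\<^esub> b)"
  unfolding lin_comb_def
  by (rule add.finprod_mono_neutral_cong_left) (use assms in \<open>auto simp: in_keys_iff\<close>)

lemma lin_comb_add:
  assumes "Poly_Mapping.keys c \<subseteq> carrier A" "Poly_Mapping.keys d \<subseteq> carrier A"
  shows "lin_comb A (c + d) = lin_comb A c \<oplus>\<^bsub>A\<^esub> lin_comb A d"
proof -
  let ?F = "Poly_Mapping.keys c \<union> Poly_Mapping.keys d"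
  have F: "finite ?F" "?F \<subseteq> carrier A" "Poly_Mapping.keys (c + d) \<subseteq> ?F"
    using assms keys_add[of c d] by auto
  have "(\<Oplus>\<^bsub>A\<^esub>b\<in>?F. Poly_Mapping.lookup (c + d) b \<odot>\<^bsub>A\<^esub> b) =
      (\<Oplus>\<^bsub>A\<^esub>b\<in>?F. Poly_Mapping.lookup c b \<odot>\<^bsub>A\<^esub> b \<oplus>\<^bsub>A\<^esub> Poly_Mapping.lookup d b \<odot>\<^bsub>A\<^esub> b)"
    using F(2) by (intro finsum_cong') (auto simp: lookup_add smult_distrib_left subset_iff)
  also have "\<dots> = (\<Oplus>\<^bsub>A\<^esub>b\<in>?F. Poly_Mapping.lookup c b \<odot>\<^bsub>A\<^esub> b) \<oplus>\<^bsub>A\<^esub>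
      (\<Oplus>\<^bsub>A\<^esub>b\<in>?F. Poly_Mapping.lookup d b \<odot>\<^bsub>A\<^esub> b)"
    using F(2) by (intro finsum_addf) auto
  finally show ?thesis using F by (simp add: lin_comb_superset[of ?F])
qed

lemma mspan_lin_comb:
  "mspan S x \<Longrightarrow> S \<subseteq> valid \<Longrightarrow> \<exists>c. Poly_Mapping.keys c \<subseteq> pmon ` S \<and> x = lin_comb A c"
proof (induction rule: lin_span.induct)
  case zero
  then show ?case by (intro exI[of _ 0]) (simp add: lin_comb_def)
next
  case (step N x d)
  then obtain c where c: "Poly_Mapping.keys c \<subseteq> pmon ` S" "x = lin_comb A c" by auto
  let ?e = "Poly_Mapping.single (pmon N) d"
  have N: "pmon N \<in> carrier A" using step by auto
  have e: "Poly_Mapping.keys ?e \<subseteq> pmon ` S" using step(1) by auto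
  have "lin_comb A ?e = (\<Oplus>\<^bsub>A\<^esub>b\<in>{pmon N}. Poly_Mapping.lookup ?e b \<odot>\<^bsub>A\<^esub> b)"
    by (rule lin_comb_superset) (use N in auto)
  also have "\<dots> = d \<odot>\<^bsub>A\<^esub> pmon N" using N by simp
  finally have "d \<odot>\<^bsub>A\<^esub> pmon N \<oplus>\<^bsub>A\<^esub> x = lin_comb A (?e + c)"
    using e c step(4) by (subst lin_comb_add) (auto simp: subset_iff)
  moreover have "Poly_Mapping.keys (?e + c) \<subseteq> pmon ` S"
    using keys_add[of ?e c] e c(1) by blast
  ultimately show ?case by blast
qed

lemma coeff_finsum:
  assumes "finite F" "F \<subseteq> basis" "N \<in> valid"
  shows "coeff (\<Oplus>\<^bsub>A\<^esub>b\<in>F. g b \<odot>\<^bsub>A\<^esub> b) N = (if pmon N \<in> F then g (pmon N) else 0)"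
  using assms(1,2)
proof (induction F)
  case (insert b F)
  then obtain M where M: "M \<in> valid" "b = pmon M" by blast
  have F: "(\<lambda>b. g b \<odot>\<^bsub>A\<^esub> b) \<in> F \<rightarrow> carrier A" using insert by auto
  have b: "g b \<odot>\<^bsub>A\<^esub> b \<in> carrier A" using M by simp
  have "coeff (\<Oplus>\<^bsub>A\<^esub>b\<in>insert b F. g b \<odot>\<^bsub>A\<^esub> b) N =
      coeff (g b \<odot>\<^bsub>A\<^esub> b) N + coeff (\<Oplus>\<^bsub>A\<^esub>b\<in>F. g b \<odot>\<^bsub>A\<^esub> b) N"
    using finsum_insert[OF insert(1,2) F b] coeff_add[OF b finsum_closed[OF F]] by simp
  moreover have "coeff (g b \<odot>\<^bsub>A\<^esub> b) N = (if pmon N = b then g b else 0)"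
    using M assms(3) inj_mon by (auto simp: coeff_smult coeff_mon inj_on_def)
  ultimately show ?case using insert by (cases "pmon N = b") auto
qed simp

lemma coeff_lin_comb:
  assumes "Poly_Mapping.keys c \<subseteq> basis" "N \<in> valid"
  shows "coeff (lin_comb A c) N = Poly_Mapping.lookup c (pmon N)"
proof -
  have "coeff (lin_comb A c) N = (if pmon N \<in> Poly_Mapping.keys c then Poly_Mapping.lookup c (pmon N) else 0)"
    unfolding lin_comb_def by (rule coeff_finsum[OF finite_keys assms])
  then show ?thesis by (simp add: in_keys_iff)
qed

lemma lin_comb_unique:
  assumes "Poly_Mapping.keys c \<subseteq> basis" "Poly_Mapping.keys d \<subseteq> basis" "lin_comb A c = lin_comb A d"
  shows "c = d"
proof (rule poly_mapping_eqI)
  fix b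
  show "Poly_Mapping.lookup c b = Poly_Mapping.lookup d b"
  proof (cases "b \<in> basis")
    case True
    then show ?thesis using coeff_lin_comb[OF assms(1)] coeff_lin_comb[OF assms(2)] assms(3) by auto
  next
    case False
    then show ?thesis using assms(1,2) by (metis in_keys_iff subsetD)
  qed
qed

lemma is_basis: "is_basis A basis"
  unfolding is_basis_def
proof (intro conjI allI impI ballI basis_carrier)
  fix c assume "Poly_Mapping.keys c \<subseteq> basis \<and> lin_comb A c = \<zero>\<^bsub>A\<^esub>"
  then show "c = 0" by (intro lin_comb_unique) (auto simp: lin_comb_def)
next
  fix f assume "f \<in> carrier A"
  then show "\<exists>c. Poly_Mapping.keys c \<subseteq> basis \<and> f = lin_comb A c"
    using carrier_mspan mspan_lin_comb by blast
qed

text \<open>Allows the support of an element to be read off from \<open>coeff\<close> instead of the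
  definite description in \<open>coords\<close>.\<close>

lemma keys_coords:
  assumes "x \<in> carrier A"
  shows "Poly_Mapping.keys (coords A basis x) = pmon ` {N \<in> valid. coeff x N \<noteq> 0}"
proof -
  obtain c where c: "Poly_Mapping.keys c \<subseteq> basis" "x = lin_comb A c"
    using assms is_basis by (auto simp: is_basis_def)
  have "coords A basis x = c"
    unfolding coords_def using c lin_comb_unique by (intro the_equality) auto
  moreover have "Poly_Mapping.keys c = pmon ` {N \<in> valid. pmon N \<in> Poly_Mapping.keys c}"
    using c(1) by blast
  moreover have "{N \<in> valid. pmon N \<in> Poly_Mapping.keys c} = {N \<in> valid. coeff x N \<noteq> 0}"
    using c by (auto simp: coeff_lin_comb in_keys_iff)
  ultimately show ?thesis by simp
qed

section \<open>Leading monomials and the monomial ordering\<close>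

definition ord :: "'a rel" where
  "ord = {(pmon M, pmon N) | M N. M \<in> valid \<and> N \<in> valid \<and> prec wt M N}"

lemma ord_mon_iff:
  assumes "M \<in> valid" "N \<in> valid"
  shows "(pmon M, pmon N) \<in> ord \<longleftrightarrow> prec wt M N"
proof
  assume "(pmon M, pmon N) \<in> ord"
  then obtain M' N' where MN: "pmon M = pmon M'" "pmon N = pmon N'" "M' \<in> valid" "N' \<in> valid" "prec wt M' N'"
    unfolding ord_def by blast
  then have "M = M'" "N = N'" using inj_onD[OF inj_mon] assms by blast+
  then show "prec wt M N" using MN(5) by simp
qed (use assms in \<open>auto simp: ord_def\<close>)

text \<open>The functional at \<open>N\<close> takes the value \<open>l\<close>, and every other
  nonvanishing one lies at an index below \<open>N\<close>. A second candidate for the maximum would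
  have to lie both above and below \<open>N\<close>.\<close>

lemma LM_eq:
  assumes N: "N \<in> valid" and l: "l \<noteq> 0" and r: "mspan (lower N) r"
  shows "LM A basis ord (l \<odot>\<^bsub>A\<^esub> pmon N \<oplus>\<^bsub>A\<^esub> r) = pmon N"
proof -
  let ?x = "l \<odot>\<^bsub>A\<^esub> pmon N \<oplus>\<^bsub>A\<^esub> r"
  have rc: "r \<in> carrier A" using r by (rule mspan_closed) auto
  then have xc: "?x \<in> carrier A" using N by auto
  have lower: "prec wt M N" "M \<in> valid" if "coeff r M \<noteq> 0" for M
    using coeff_mspan[OF r _ that] by auto
  have eq: "coeff ?x M = (if N = M then l else 0) + coeff r M" for M
    using N rc by (simp add: coeff_add coeff_smult coeff_mon)
  have "coeff r N = 0" using lower(1)[of N] by auto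
  then have xN: "coeff ?x N \<noteq> 0" using l by (simp add: eq)
  then have nz: "?x \<noteq> \<zero>\<^bsub>A\<^esub>" by auto
  have top: "prec wt M N" if "coeff ?x M \<noteq> 0" "M \<noteq> N" for M
    using that lower(1) by (auto simp: eq)
  have "(THE b. b \<in> pmon ` {N \<in> valid. coeff ?x N \<noteq> 0} \<and>
      (\<forall>b'\<in>pmon ` {N \<in> valid. coeff ?x N \<noteq> 0}. b' \<noteq> b \<longrightarrow> (b', b) \<in> ord)) = pmon N"
  proof (rule the_equality)
    show "pmon N \<in> pmon ` {N \<in> valid. coeff ?x N \<noteq> 0} \<and>
      (\<forall>b'\<in>pmon ` {N \<in> valid. coeff ?x N \<noteq> 0}. b' \<noteq> pmon N \<longrightarrow> (b', pmon N) \<in> ord)"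
      using xN N top by (auto simp: ord_def)
  next
    fix b assume b: "b \<in> pmon ` {N \<in> valid. coeff ?x N \<noteq> 0} \<and>
      (\<forall>b'\<in>pmon ` {N \<in> valid. coeff ?x N \<noteq> 0}. b' \<noteq> b \<longrightarrow> (b', b) \<in> ord)"
    then obtain M where M: "b = pmon M" "M \<in> valid" "coeff ?x M \<noteq> 0" by blast
    show "b = pmon N"
    proof (rule ccontr)
      assume "b \<noteq> pmon N"
      then have "(pmon N, pmon M) \<in> ord" using b xN N M(1) by auto
      then have "prec wt N M" using ord_mon_iff N M by simp
      moreover have "prec wt M N" using top M \<open>b \<noteq> pmon N\<close> by blast
      ultimately show False using prec_trans prec_irrefl by blast
    qed
  qed
  then show ?thesis using nz by (simp add: LM_def keys_coords[OF xc])
qed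

lemma LM_wprod:
  assumes "set w \<subseteq> {..<length as}"
  shows "LM A basis ord (wprod w) = pmon (mset w)"
proof -
  obtain l r where "l \<noteq> 0" "mspan (lower (mset w)) r" "wprod w = l \<odot>\<^bsub>A\<^esub> pmon (mset w) \<oplus>\<^bsub>A\<^esub> r"
    using straighten[OF assms] by blast
  then show ?thesis using LM_eq[of "mset w"] assms by simp
qed

text \<open>Straightening keeps the content of a word up to a nonzero factor and lower terms, so
  leading monomials multiply as multisets add. The axioms of a monomial ordering thereby become
  compatibility of \<open>prec\<close> with addition.\<close>

lemma LM_mult3:
  assumes "L \<in> valid" "M \<in> valid" "N \<in> valid"
  shows "LM A basis ord (pmon L \<otimes>\<^bsub>A\<^esub> pmon M \<otimes>\<^bsub>A\<^esub> pmon N) = pmon (L + M + N)"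
proof -
  have "pmon L \<otimes>\<^bsub>A\<^esub> pmon M \<otimes>\<^bsub>A\<^esub> pmon N = wprod ((sorted_list_of_multiset L @ sorted_list_of_multiset M) @ sorted_list_of_multiset N)"
    using assms by (subst wprod_append) (auto simp: wprod_append sorted_mon_def)
  then show ?thesis using assms LM_wprod[of "(sorted_list_of_multiset L @ sorted_list_of_multiset M) @ sorted_list_of_multiset N"]
    by (simp add: add.assoc)
qed

lemma wf_ord: "wf ord"
proof -
  define f where "f = the_inv_into valid pmon"
  have "ord \<subseteq> inv_image {(M, N). prec wt M N} f"
    by (auto simp: ord_def f_def the_inv_into_f_f[OF inj_mon])
  then show ?thesis using wf_inv_image[OF wf_prec] wf_subset by blast
qed

lemma strict_linear_order_ord: "strict_linear_order_on basis ord"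
  unfolding strict_linear_order_on_def
proof (intro conjI)
  show "trans ord"
  proof (rule transI)
    fix x y z assume "(x, y) \<in> ord" "(y, z) \<in> ord"
    then obtain L M M' N where "x = pmon L" "y = pmon M" "y = pmon M'" "z = pmon N"
      "L \<in> valid" "M \<in> valid" "M' \<in> valid" "N \<in> valid" "prec wt L M" "prec wt M' N"
      unfolding ord_def by blast
    moreover from this have "M = M'" using inj_mon by (auto simp: inj_on_def)
    ultimately show "(x, z) \<in> ord" using ord_mon_iff prec_trans by blast
  qed
  show "irrefl ord" using wf_ord by (simp add: irrefl_def wf_irrefl)
  show "total_on basis ord"
  proof (rule total_onI)
    fix x y assume "x \<in> basis" "y \<in> basis" "x \<noteq> y"
    then obtain M N where "x = pmon M" "y = pmon N" "M \<in> valid" "N \<in> valid" "M \<noteq> N" by blast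
    then show "(x, y) \<in> ord \<or> (y, x) \<in> ord" using ord_mon_iff prec_linear by blast
  qed
qed

lemma monomial_ordering_ord: "monomial_ordering A basis ord"
  unfolding monomial_ordering_def
proof (intro conjI ballI impI wf_ord strict_linear_order_ord)
  show "ord \<subseteq> basis \<times> basis" by (auto simp: ord_def)
next
  fix u a b e
  assume "u \<in> basis" "a \<in> basis" "b \<in> basis" "e \<in> basis"
    and u: "u \<noteq> \<one>\<^bsub>A\<^esub> \<and> b \<noteq> u \<and> u = LM A basis ord (a \<otimes>\<^bsub>A\<^esub> b \<otimes>\<^bsub>A\<^esub> e)"
  then obtain L M N where LMN: "a = pmon L" "b = pmon M" "e = pmon N" "L \<in> valid" "M \<in> valid" "N \<in> valid"
    by blast
  then have ueq: "u = pmon (M + (L + N))" using u LM_mult3 by (simp add: ac_simps)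
  \<comment> \<open>\<open>b \<noteq> u\<close> means that the two outer factors are not both the
    unit.\<close>
  then have "L + N \<noteq> {#}" using u LMN(2) by (metis add.right_neutral)
  then have "prec wt M (M + (L + N))" by (rule prec_add_nonempty)
  moreover have "M + (L + N) \<in> valid" using LMN by auto
  ultimately show "(b, u) \<in> ord" unfolding ueq LMN(2) using ord_mon_iff LMN(5) by blast
next
  fix u a b e
  assume "u \<in> basis" "a \<in> basis" "b \<in> basis" "e \<in> basis"
    and ab: "(a, b) \<in> ord \<and> LM A basis ord (u \<otimes>\<^bsub>A\<^esub> a \<otimes>\<^bsub>A\<^esub> e) \<noteq> \<zero>\<^bsub>A\<^esub> \<and>
      LM A basis ord (u \<otimes>\<^bsub>A\<^esub> b \<otimes>\<^bsub>A\<^esub> e) \<notin> {\<zero>\<^bsub>A\<^esub>, \<one>\<^bsub>A\<^esub>}"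
  then obtain U L M N where LMN: "u = pmon U" "a = pmon L" "b = pmon M" "e = pmon N"
      "U \<in> valid" "L \<in> valid" "M \<in> valid" "N \<in> valid"
    by blast
  then have "prec wt L M" using ab ord_mon_iff by blast
  then have "prec wt (U + L + N) (U + M + N)" by (simp add: prec_add_left prec_add_right)
  moreover have "U + L + N \<in> valid" "U + M + N \<in> valid" using LMN by auto
  ultimately show "(LM A basis ord (u \<otimes>\<^bsub>A\<^esub> a \<otimes>\<^bsub>A\<^esub> e), LM A basis ord (u \<otimes>\<^bsub>A\<^esub> b \<otimes>\<^bsub>A\<^esub> e)) \<in> ord"
    using LMN LM_mult3 ord_mon_iff by simp
qed

section \<open>Exponent vectors as sorted words\<close>

definition pbw_word :: "nat list \<Rightarrow> nat list" where
  "pbw_word \<alpha> = concat (map (\<lambda>i. replicate (\<alpha> ! i) i) [0..<length as])"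

lemma count_pbw_word: "count (mset (pbw_word \<alpha>)) i = (if i < length as then \<alpha> ! i else 0)"
  by (simp add: pbw_word_def count_concat_replicate)

lemma pbw_word_valid: "mset (pbw_word \<alpha>) \<in> valid"
  by (auto simp: pbw_word_def)

lemma pbw_monomial_eq:
  assumes "length \<alpha> = length as"
  shows "pbw_monomial A as \<alpha> = pmon (mset (pbw_word \<alpha>))"
proof -
  have pow: "(as ! i [^]\<^bsub>A\<^esub> k) \<otimes>\<^bsub>A\<^esub> wprod w = wprod (replicate k i @ w)"
    if "i < length as" "set w \<subseteq> {..<length as}" for i k w
  proof (induction k)
    case (Suc k)
    have "as ! i [^]\<^bsub>A\<^esub> Suc k = as ! i \<otimes>\<^bsub>A\<^esub> as ! i [^]\<^bsub>A\<^esub> k"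
      using that by (intro nat_pow_Suc2) simp
    then show ?case using that Suc by (simp add: m_assoc del: nat_pow_Suc)
  qed (use that in simp)
  have "foldr (\<lambda>i x. (as ! i [^]\<^bsub>A\<^esub> (\<alpha> ! i)) \<otimes>\<^bsub>A\<^esub> x) is \<one>\<^bsub>A\<^esub> =
      wprod (concat (map (\<lambda>i. replicate (\<alpha> ! i) i) is))" if "set is \<subseteq> {..<length as}" for "is"
    using that by (induction "is") (auto intro!: pow)
  moreover have "zip as \<alpha> = map (\<lambda>i. (as ! i, \<alpha> ! i)) [0..<length as]"
    using assms by (intro nth_equalityI) auto
  ultimately have "pbw_monomial A as \<alpha> = wprod (pbw_word \<alpha>)"
    unfolding pbw_monomial_def pbw_word_def by (simp add: foldr_map comp_def lessThan_atLeast0)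
  moreover have "sorted (pbw_word \<alpha>)"
    unfolding pbw_word_def by (rule sorted_concat_replicate) simp
  ultimately show ?thesis by (simp add: mon_mset_sorted)
qed

lemma pbw_monomials_eq: "pbw_monomials A as = basis"
proof -
  let ?E = "{\<alpha>. length \<alpha> = length as}"
  have "valid \<subseteq> (\<lambda>\<alpha>. mset (pbw_word \<alpha>)) ` ?E"
  proof
    fix N assume N: "N \<in> valid"
    show "N \<in> (\<lambda>\<alpha>. mset (pbw_word \<alpha>)) ` ?E"
    proof (rule image_eqI)
      show "N = mset (pbw_word (map (count N) [0..<length as]))"
        using N by (intro multiset_eqI) (auto simp: count_pbw_word count_eq_zero_iff)
    qed simp
  qed
  moreover have "(\<lambda>\<alpha>. mset (pbw_word \<alpha>)) ` ?E \<subseteq> valid"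
    using pbw_word_valid by (intro image_subsetI)
  ultimately have "valid = (\<lambda>\<alpha>. mset (pbw_word \<alpha>)) ` ?E" by (rule subset_antisym)
  then have "basis = (\<lambda>\<alpha>. pmon (mset (pbw_word \<alpha>))) ` ?E" by (simp only: image_image)
  also have "\<dots> = pbw_monomial A as ` ?E"
    by (rule image_cong[OF refl]) (simp add: pbw_monomial_eq)
  finally show ?thesis by (simp add: pbw_monomials_def)
qed

lemma inj_pbw_monomial: "inj_on (pbw_monomial A as) {\<alpha>. length \<alpha> = length as}"
proof (rule inj_onI)
  fix \<alpha> \<beta> assume len: "\<alpha> \<in> {\<alpha>. length \<alpha> = length as}" "\<beta> \<in> {\<alpha>. length \<alpha> = length as}"
    and "pbw_monomial A as \<alpha> = pbw_monomial A as \<beta>"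
  then have "mset (pbw_word \<alpha>) = mset (pbw_word \<beta>)"
    using inj_onD[OF inj_mon] pbw_word_valid by (simp add: pbw_monomial_eq)
  then have "\<alpha> ! i = \<beta> ! i" if "i < length as" for i
    using that count_pbw_word[of \<alpha> i] count_pbw_word[of \<beta> i] by simp
  then show "\<alpha> = \<beta>" using len by (intro nth_equalityI) auto
qed

theorem solvable: "solvable_polynomial_algebra A as"
  unfolding solvable_polynomial_algebra_def has_pbw_basis_def pbw_monomials_eq
proof (intro conjI generators is_basis inj_pbw_monomial exI[of _ ord] monomial_ordering_ord allI impI)
  show "assoc_algebra (ring_of_type_algebra :: 'k ring) A" by (rule assoc_algebra_axioms)
next
  fix i j assume ij: "i < j \<and> j < length as"
  then obtain l c s t where l: "l \<noteq> 0" "s \<le> t" "t < length as" "c = 0 \<or> wt s + wt t < wt i + wt j"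
    and rel: "as ! j \<otimes>\<^bsub>A\<^esub> as ! i = l \<odot>\<^bsub>A\<^esub> (as ! i \<otimes>\<^bsub>A\<^esub> as ! j) \<oplus>\<^bsub>A\<^esub> c \<odot>\<^bsub>A\<^esub> (as ! s \<otimes>\<^bsub>A\<^esub> as ! t)"
    using quasi_comm by blast
  let ?f = "c \<odot>\<^bsub>A\<^esub> (as ! s \<otimes>\<^bsub>A\<^esub> as ! t)"
  have mon2: "as ! a \<otimes>\<^bsub>A\<^esub> as ! b = pmon {#a, b#}" if "a \<le> b" "b < length as" for a b
    using that mon_mset_sorted[of "[a, b]"] by simp
  have "(LM A basis ord ?f, as ! i \<otimes>\<^bsub>A\<^esub> as ! j) \<in> ord" if f: "?f \<noteq> \<zero>\<^bsub>A\<^esub>"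
  proof -
    have c: "c \<noteq> 0" using f l(2,3) by auto
    \<comment> \<open>A zero remainder and \<open>l = c\<close> bring the correction term into the
      shape required by \<open>LM_eq\<close>.\<close>
    have "LM A basis ord (c \<odot>\<^bsub>A\<^esub> pmon {#s, t#} \<oplus>\<^bsub>A\<^esub> \<zero>\<^bsub>A\<^esub>) = pmon {#s, t#}"
      using l(2,3) c by (intro LM_eq) (auto intro: lin_span.zero)
    then have "LM A basis ord ?f = pmon {#s, t#}" using l(2,3) by (simp add: mon2)
    moreover have "prec wt {#s, t#} {#i, j#}" using c l(4) by (simp add: prec_def)
    ultimately show ?thesis using ij l(2,3) by (simp add: mon2 ord_mon_iff)
  qed
  moreover have "?f \<in> carrier A" using l(2,3) by simp
  ultimately show "\<exists>l f. l \<noteq> 0 \<and> f \<in> carrier A \<and>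
      as ! j \<otimes>\<^bsub>A\<^esub> as ! i = l \<odot>\<^bsub>A\<^esub> (as ! i \<otimes>\<^bsub>A\<^esub> as ! j) \<oplus>\<^bsub>A\<^esub> f \<and>
      (f \<noteq> \<zero>\<^bsub>A\<^esub> \<longrightarrow> (LM A basis ord f, as ! i \<otimes>\<^bsub>A\<^esub> as ! j) \<in> ord)"
    using l(1) rel by blast
qed

end

section \<open>The Dipper--Donkin algebra\<close>

lemma lift_op_diff: "lift_op D (p - r) = lift_op D p - lift_op D r"
  using lift_op_add[of D "p - r" r] by simp

lemma lift_op_scalar: "lift_op D (scalar c) = c \<star> 1"
  by (simp add: scalar_def lift_op_single zero_word_def)

lemma lift_op_gen: "lift_op D (free_gen g) = D g"
  by (simp add: free_gen_def lift_op_single)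

lemma free_algebra_diff_closed:
  "p \<in> carrier (free_algebra L) \<Longrightarrow> r \<in> carrier (free_algebra L) \<Longrightarrow> p - r \<in> carrier (free_algebra L)"
  using free_algebra_add_closed[OF _ free_algebra_uminus_closed] by simp

lemma ideal_lift_op_kernel:
  "ideal {p \<in> carrier (free_algebra L). lift_op D p = 0} (free_algebra L)"
proof (rule idealI[OF ring_free_algebra])
  interpret ring "free_algebra L" by (rule ring_free_algebra)
  show "subgroup {p \<in> carrier (free_algebra L). lift_op D p = 0} (add_monoid (free_algebra L))"
  proof (rule add.subgroupI)
    show "{p \<in> carrier (free_algebra L). lift_op D p = 0} \<noteq> {}"
      using free_algebra_zero_closed by fastforce
  next
    fix p assume p: "p \<in> {p \<in> carrier (free_algebra L). lift_op D p = 0}"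
    then have "\<ominus>\<^bsub>free_algebra L\<^esub> p = - p"
      by (intro minus_equality) (simp_all add: free_algebra_uminus_closed)
    then show "\<ominus>\<^bsub>free_algebra L\<^esub> p \<in> {p \<in> carrier (free_algebra L). lift_op D p = 0}"
      using p lift_op_diff[of D 0 p] by (simp add: free_algebra_uminus_closed)
  qed (auto simp: lift_op_add free_algebra_add_closed)
qed (auto simp: lift_op_mult free_algebra_mult_closed)

context
  fixes q :: "'k::field" and n :: nat
  notes One_nat_def [simp del]
begin

abbreviation (input) "FA \<equiv> (free_algebra ({1..n} \<times> {1..n}) :: ('k, (nat \<times> nat) word \<Rightarrow>\<^sub>0 'k) module)"
abbreviation (input) "cls x \<equiv> dd_ideal q n +>\<^bsub>FA\<^esub> x"
abbreviation (input) "DD \<equiv> dipper_donkin q n"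
abbreviation (input) "repr \<equiv> lift_op (\<lambda>(i, j). dd_op q n 0 i j)"

lemma dd_relations_carrier: "dd_relations q n \<subseteq> carrier FA"
  unfolding dd_relations_def
  by (auto intro!: free_algebra_diff_closed free_algebra_mult_closed free_algebra_add_closed
      free_algebra_scalar_closed free_algebra_gen_closed)

lemma ideal_dd: "ideal (dd_ideal q n) FA"
proof -
  interpret ring FA by (rule ring_free_algebra)
  show ?thesis
    unfolding dd_ideal_def dd_free_algebra_def by (rule genideal_ideal[OF dd_relations_carrier])
qed

text \<open>The kernel of the representation is an ideal containing the defining relations, hence
  contains the ideal they generate. This lets the representation descend to the quotient.\<close>

lemma dd_ideal_kernel: "dd_ideal q n \<subseteq> {p \<in> carrier FA. repr p = 0}"
proof -
  interpret ring FA by (rule ring_free_algebra)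
  note lift = lift_op_diff lift_op_add lift_op_scalar lift_op_mult lift_op_gen
  have "repr p = 0" if "p \<in> dd_relations q n" for p
    using that unfolding dd_relations_def
  proof (elim UnE CollectE exE conjE)
    fix i j s t assume "i > s" "j \<le> t"
      and "p = free_gen (i, j) * free_gen (s, t) - scalar q * (free_gen (s, t) * free_gen (i, j))"
    then show ?thesis by (simp add: lift dd_op_less)
  next
    fix i j s t assume "i > s" "j > t"
      and "p = free_gen (i, j) * free_gen (s, t) -
        (free_gen (s, t) * free_gen (i, j) + scalar (q - 1) * (free_gen (s, j) * free_gen (i, t)))"
    then show ?thesis by (simp add: lift dd_op_less)
  next
    fix i j k assume "p = free_gen (i, j) * free_gen (i, k) - free_gen (i, k) * free_gen (i, j)"
    then show ?thesis by (simp add: lift dd_op_commute)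
  qed
  then show ?thesis
    unfolding dd_ideal_def dd_free_algebra_def
    using dd_relations_carrier by (intro genideal_minimal[OF ideal_lift_op_kernel]) blast
qed

lemma dipper_donkin_eq: "dipper_donkin q n = quotient_algebra FA (dd_ideal q n)"
  by (simp add: dipper_donkin_def dd_free_algebra_def)

lemmas cls_simps =
  quotient_algebra_add[OF assoc_algebra_free_algebra ideal_dd, folded dipper_donkin_eq]
  quotient_algebra_mult[OF assoc_algebra_free_algebra ideal_dd, folded dipper_donkin_eq]
  quotient_algebra_smult[OF assoc_algebra_free_algebra ideal_dd, folded dipper_donkin_eq]
  quotient_algebra_one[OF assoc_algebra_free_algebra ideal_dd, folded dipper_donkin_eq]

lemma cls_eqI:
  assumes "p - r \<in> dd_ideal q n" "r \<in> carrier FA"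
  shows "cls p = cls r"
proof -
  interpret ideal "dd_ideal q n" FA by (rule ideal_dd)
  have "p \<in> cls r" using assms by (auto simp: a_r_coset_def' intro!: bexI[of _ "p - r"])
  then show ?thesis using a_repr_independence' assms(2) by blast
qed

lemma cls_relation_eqI:
  assumes "p - r \<in> dd_relations q n" "r \<in> carrier FA"
  shows "cls p = cls r"
proof (rule cls_eqI[OF _ assms(2)])
  interpret ring FA by (rule ring_free_algebra)
  show "p - r \<in> dd_ideal q n"
    using genideal_self[OF dd_relations_carrier] assms(1)
    by (auto simp: dd_ideal_def dd_free_algebra_def)
qed

text \<open>The representation descended to cosets; the choice of representative is harmless by
  \<open>dd_ideal_kernel\<close>.\<close>

definition cls_op :: "((nat \<times> nat) word \<Rightarrow>\<^sub>0 'k) set \<Rightarrow> 'k mop" where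
  "cls_op C = repr (SOME p. p \<in> C)"

lemma cls_op_eq:
  assumes "p \<in> carrier FA"
  shows "cls_op (cls p) = repr p"
proof -
  interpret ideal "dd_ideal q n" FA by (rule ideal_dd)
  have "(SOME r. r \<in> cls p) \<in> cls p" using a_rcos_self[OF assms] by (rule someI)
  then obtain i where "i \<in> dd_ideal q n" "(SOME r. r \<in> cls p) = i + p"
    by (auto simp: a_r_coset_def')
  then show ?thesis using dd_ideal_kernel by (auto simp: cls_op_def lift_op_add)
qed

text \<open>Translates zero-based list positions into one-based index pairs, row by row. It is
  injective on all natural numbers, so multisets of positions can be recovered from their images
  without any bound on the positions.\<close>

definition index :: "nat \<Rightarrow> nat \<times> nat" where
  "index i = (Suc (i div n), Suc (i mod n))"

lemma inj_index: "inj index"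
proof (rule injI)
  fix i j assume "index i = index j"
  then have "i div n = j div n" "i mod n = j mod n" by (simp_all add: index_def)
  then show "i = j" by (metis div_mult_mod_eq)
qed

lemma index_mem: "i < n * n \<Longrightarrow> index i \<in> {1..n} \<times> {1..n}"
  by (cases "n = 0") (auto simp: index_def less_mult_imp_div_less Suc_le_eq)

lemma index_ex:
  assumes "a \<in> {1..n}" "b \<in> {1..n}"
  obtains i where "i < n * n" "index i = (a, b)" "i = (a - 1) * n + (b - 1)"
proof -
  have "(a - 1) * n + (b - 1) < (a - 1) * n + n" using assms by auto
  also have "\<dots> = a * n" using assms by (cases a) auto
  also have "\<dots> \<le> n * n" using assms by simp
  finally have "(a - 1) * n + (b - 1) < n * n" .
  moreover have "index ((a - 1) * n + (b - 1)) = (a, b)"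
    using assms by (cases a; cases b) (simp_all add: index_def One_nat_def)
  ultimately show ?thesis using that by blast
qed

lemma length_dd_gens [simp]: "length (dd_gens q n) = n * n"
  by (simp add: dd_gens_def)

lemma dd_gens_nth: "i < n * n \<Longrightarrow> dd_gens q n ! i = cls (free_gen (index i))"
  by (cases "n = 0")
    (simp_all add: dd_gens_def product_nth dd_gen_def dd_free_algebra_def index_def less_mult_imp_div_less
      One_nat_def del: upt_Suc)

lemma single_index_closed:
  assumes "set w \<subseteq> {..<n * n}"
  shows "Poly_Mapping.single (Word (map index w)) c \<in> carrier FA"
proof (rule free_algebra_single_closed)
  show "set (letters (Word (map index w))) \<subseteq> {1..n} \<times> {1..n}"
    using assms index_mem by (simp only: word.sel set_map) blast
qed

lemma word_prod_dd_gens: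
  "set w \<subseteq> {..<n * n} \<Longrightarrow>
    word_prod DD (dd_gens q n) w = cls (Poly_Mapping.single (Word (map index w)) 1)"
proof (induction w)
  case Nil
  then show ?case using cls_simps(4) by (simp add: word_prod_def flip: single_one zero_word_def)
next
  case (Cons i w)
  have "Poly_Mapping.single (Word (map index (i # w))) (1::'k) =
      free_gen (index i) * Poly_Mapping.single (Word (map index w)) 1"
    by (simp add: free_gen_def mult_single plus_word_def)
  moreover have "free_gen (index i) \<in> carrier FA"
    using Cons.prems by (intro free_algebra_gen_closed index_mem) simp
  moreover have "Poly_Mapping.single (Word (map index w)) 1 \<in> carrier FA"
    using Cons.prems by (intro single_index_closed) simp
  ultimately have "cls (Poly_Mapping.single (Word (map index (i # w))) 1) =
      cls (free_gen (index i)) \<otimes>\<^bsub>DD\<^esub> cls (Poly_Mapping.single (Word (map index w)) 1)"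
    using cls_simps(2) by simp
  then show ?case using Cons by (simp add: word_prod_def dd_gens_nth)
qed

text \<open>A matrix coefficient of the representation: the image of the unit vector at the empty
  multiset, evaluated at \<open>N\<close>. Sorted monomials send that vector to distinct unit
  vectors, so these functionals are dual to them.\<close>

definition dd_coeff :: "((nat \<times> nat) word \<Rightarrow>\<^sub>0 'k) set \<Rightarrow> nat multiset \<Rightarrow> 'k" where
  "dd_coeff C N = op_apply (cls_op C) (delta {#}) (image_mset index N)"

lemma dd_coeff_monomial:
  assumes "set_mset M \<subseteq> {..<n * n}"
  shows "dd_coeff (sorted_mon DD (dd_gens q n) M) N = (if M = N then 1 else 0)"
proof -
  let ?w = "sorted_list_of_multiset M"
  have w: "set ?w \<subseteq> {..<n * n}" using assms by simp
  have "Poly_Mapping.single (Word (map index ?w)) 1 \<in> carrier FA"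
    using w by (rule single_index_closed)
  then have "cls_op (sorted_mon DD (dd_gens q n) M) =
      prod_list (map (\<lambda>(i, j). dd_op q n 0 i j) (map index ?w))"
    using w by (simp add: sorted_mon_def word_prod_dd_gens cls_op_eq lift_op_single)
  moreover have "op_apply (prod_list (map (\<lambda>(i, j). dd_op q n 0 i j) (map index ?w))) (delta {#}) =
      delta (mset (map index ?w))"
  proof (rule dd_op_word_delta)
    have "sorted (map (fst \<circ> index) ?w)"
      by (rule sorted_map_mono) (auto simp: index_def mono_on_def div_le_mono)
    then show "sorted (map fst (map index ?w))" by simp
    show "snd e \<in> {1..n}" if "e \<in> set (map index ?w)" for e
      using that w index_mem by fastforce
  qed
  moreover have "image_mset index N = image_mset index M \<longleftrightarrow> M = N"
    using inj_eq[OF multiset.inj_map[OF inj_index]] by auto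
  ultimately show ?thesis by (auto simp: dd_coeff_def delta_def)
qed

lemma carrier_DD: "carrier DD = (\<lambda>x. cls x) ` carrier FA"
  unfolding dipper_donkin_eq by (rule carrier_quotient_algebra[OF assoc_algebra_free_algebra ideal_dd])

lemma generates_DD: "generates_algebra DD (set (dd_gens q n))"
proof -
  have "set (dd_gens q n) = (\<lambda>x. cls x) ` free_gen ` ({1..n} \<times> {1..n})"
    by (auto simp: dd_gens_def dd_gen_def dd_free_algebra_def image_image simp del: upt_Suc)
  then show ?thesis
    unfolding dipper_donkin_eq
    using generates_quotient[OF assoc_algebra_free_algebra ideal_dd generates_free_algebra] by simp
qed

definition dd_weight :: "nat \<Rightarrow> nat" where
  "dd_weight i = fst (index i) * snd (index i)"

lemma dd_quasi_comm:
  assumes q: "q \<noteq> 0" and ij: "i < j" "j < n * n"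
  shows "\<exists>l c s t. l \<noteq> 0 \<and> s \<le> t \<and> t < n * n \<and>
    (c = 0 \<or> dd_weight s + dd_weight t < dd_weight i + dd_weight j) \<and>
    dd_gens q n ! j \<otimes>\<^bsub>DD\<^esub> dd_gens q n ! i =
      l \<odot>\<^bsub>DD\<^esub> (dd_gens q n ! i \<otimes>\<^bsub>DD\<^esub> dd_gens q n ! j) \<oplus>\<^bsub>DD\<^esub>
      c \<odot>\<^bsub>DD\<^esub> (dd_gens q n ! s \<otimes>\<^bsub>DD\<^esub> dd_gens q n ! t)"
proof -
  obtain a b s t where abst: "index j = (a, b)" "index i = (s, t)" by fastforce
  then have range: "{a, b, s, t} \<subseteq> {1..n}" using ij index_mem[of i] index_mem[of j] by auto
  then have gen [simp]: "free_gen (x, y) \<in> carrier FA" if "x \<in> {a, b, s, t}" "y \<in> {a, b, s, t}" for x y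
    using that by (auto intro!: free_algebra_gen_closed)
  have prod: "dd_gens q n ! k \<otimes>\<^bsub>DD\<^esub> dd_gens q n ! l = cls (free_gen (index k) * free_gen (index l))"
    if "k < n * n" "l < n * n" for k l
    using that index_mem[of k] index_mem[of l] cls_simps(2)[of "free_gen (index k)" "free_gen (index l)"]
    by (simp add: dd_gens_nth free_algebra_gen_closed)
  have comb: "l \<odot>\<^bsub>DD\<^esub> cls x \<oplus>\<^bsub>DD\<^esub> c \<odot>\<^bsub>DD\<^esub> cls y = cls (scalar l * x + scalar c * y)"
    if "x \<in> carrier FA" "y \<in> carrier FA" for l c x y
    using that cls_simps(1)[of "scalar l * x" "scalar c * y"] cls_simps(3)[of x l] cls_simps(3)[of y c]
    by (simp add: free_algebra_mult_closed free_algebra_scalar_closed)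
  have scalars: "scalar 0 = (0 :: (nat \<times> nat) word \<Rightarrow>\<^sub>0 'k)" "scalar 1 = (1 :: (nat \<times> nat) word \<Rightarrow>\<^sub>0 'k)"
    by (simp_all add: scalar_def)
  let ?x = "free_gen (a, b) * free_gen (s, t) :: (nat \<times> nat) word \<Rightarrow>\<^sub>0 'k"
  let ?y = "free_gen (s, t) * free_gen (a, b) :: (nat \<times> nat) word \<Rightarrow>\<^sub>0 'k"
  have scaled: "scalar c * x \<in> carrier FA" if "x \<in> carrier FA" for c x
    using that by (intro free_algebra_mult_closed free_algebra_scalar_closed)
  have carr: "?x \<in> carrier FA" "?y \<in> carrier FA" by (simp_all add: free_algebra_mult_closed)
  have "s \<le> a" using ij abst by (auto simp: index_def div_le_mono)
  then consider "a = s" | "s < a" "b \<le> t" | "s < a" "t < b" by linarith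
  then show ?thesis
  proof cases
    case 1
    have "?x - ?y \<in> dd_relations q n"
      unfolding dd_relations_def using range 1 by blast
    then have "cls ?x = cls ?y" using carr by (intro cls_relation_eqI)
    then show ?thesis using ij abst carr
      \<comment> \<open>With correction coefficient 0, the pair \<open>i\<close>, \<open>j\<close>
        is a placeholder that meets the bounds on positions.\<close>
      by (intro exI[of _ 1] exI[of _ 0] exI[of _ i] exI[of _ j]) (simp add: prod comb scalars)
  next
    case 2
    have "?x - scalar q * ?y \<in> dd_relations q n"
      unfolding dd_relations_def using range 2 by blast
    then have "cls ?x = cls (scalar q * ?y)"
      using carr by (intro cls_relation_eqI scaled)
    then show ?thesis using ij abst carr q
      by (intro exI[of _ q] exI[of _ 0] exI[of _ i] exI[of _ j]) (simp add: prod comb scalars)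
  next
    case 3
    let ?z = "free_gen (s, b) * free_gen (a, t) :: (nat \<times> nat) word \<Rightarrow>\<^sub>0 'k"
    have z: "?z \<in> carrier FA" by (simp add: free_algebra_mult_closed)
    have "?x - (?y + scalar (q - 1) * ?z) \<in> dd_relations q n"
      unfolding dd_relations_def using range 3 by blast
    then have rel: "cls ?x = cls (?y + scalar (q - 1) * ?z)"
      using carr z by (intro cls_relation_eqI free_algebra_add_closed scaled)
    obtain k where k: "k < n * n" "index k = (s, b)" "k = (s - 1) * n + (b - 1)"
      using index_ex[of s b] range by auto
    obtain l where l: "l < n * n" "index l = (a, t)" "l = (a - 1) * n + (t - 1)"
      using index_ex[of a t] range by auto
    \<comment> \<open>The factor \<open>d_sb\<close> lies in row \<open>s < a\<close>, and row
      \<open>s\<close> ends before row \<open>a\<close> begins; the correction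
      \<open>d_sb d_at\<close> is therefore already sorted.\<close>
    have "(s - 1) * n + n = s * n" using range by (cases s) auto
    moreover have "s * n \<le> (a - 1) * n" using 3 by (intro mult_le_mono1) simp
    moreover have "b - 1 \<le> n" using range by auto
    ultimately have "k \<le> l" unfolding k(3) l(3) by linarith
    moreover have "dd_weight k + dd_weight l < dd_weight i + dd_weight j"
    proof -
      \<comment> \<open>This is \<open>(a - s)(b - t) > 0\<close> multiplied out, over the integers
        because subtraction of naturals truncates.\<close>
      have "int s * int b + int a * int t < int s * int t + int a * int b"
        using mult_pos_pos[of "int a - int s" "int b - int t"] 3 by (simp add: algebra_simps)
      then have "int (s * b + a * t) < int (s * t + a * b)" by simp
      then show ?thesis unfolding of_nat_less_iff by (simp add: dd_weight_def abst k(2) l(2))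
    qed
    ultimately show ?thesis using ij abst carr z l k rel
      by (intro exI[of _ 1] exI[of _ "q - 1"] exI[of _ k] exI[of _ l]) (simp add: prod comb scalars)
  qed
qed

lemma cls_op_add_smult:
  assumes "C \<in> carrier DD" "C' \<in> carrier DD"
  shows "cls_op (C \<oplus>\<^bsub>DD\<^esub> C') = cls_op C + cls_op C'" "cls_op (c \<odot>\<^bsub>DD\<^esub> C) = c \<star> cls_op C"
proof -
  obtain p r where p: "p \<in> carrier FA" "C = cls p" and r: "r \<in> carrier FA" "C' = cls r"
    using assms by (auto simp: carrier_DD)
  have "p + r \<in> carrier FA" "scalar c * p \<in> carrier FA"
    using p r by (simp_all add: free_algebra_add_closed free_algebra_mult_closed free_algebra_scalar_closed)
  moreover have "C \<oplus>\<^bsub>DD\<^esub> C' = cls (p + r)" "c \<odot>\<^bsub>DD\<^esub> C = cls (scalar c * p)"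
    using p r cls_simps(1)[of p r] cls_simps(3)[of p c] by simp_all
  ultimately show "cls_op (C \<oplus>\<^bsub>DD\<^esub> C') = cls_op C + cls_op C'" "cls_op (c \<odot>\<^bsub>DD\<^esub> C) = c \<star> cls_op C"
    using p r by (simp_all add: cls_op_eq lift_op_add lift_op_mult lift_op_scalar)
qed

lemma quasi_commuting_DD:
  assumes "q \<noteq> 0"
  shows "quasi_commuting DD (dd_gens q n) dd_weight dd_coeff"
proof (intro quasi_commuting.intro quasi_commuting_axioms.intro generates_DD)
  show "assoc_algebra ring_of_type_algebra DD"
    unfolding dipper_donkin_eq by (rule assoc_algebra_quotient[OF assoc_algebra_free_algebra ideal_dd])
qed (use assms dd_quasi_comm dd_coeff_monomial in
    \<open>simp_all add: dd_coeff_def cls_op_add_smult op_apply_simps\<close>)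

end

theorem theorem3p3:
  fixes q :: "'k::field_char_0" and n :: nat
  assumes "q \<noteq> 0" and "n \<ge> 2"
  shows "solvable_polynomial_algebra (dipper_donkin q n) (dd_gens q n)"
  using quasi_commuting_DD[OF assms(1)] by (rule quasi_commuting.solvable)

end
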